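(* Let $A:=\begin{bmatrix}A_{11}&A_{12}\\ 0&A_{22}\end{bmatrix}$ and $E:=\begin{bmatrix}E_{11}&E_{12}\\ E_{21}&E_{22}\end{bmatrix}$ be $n\times n$ complex matrices, where $A_{11}$ and $E_{11}$ are $m\times m$ matrices. Suppose that $s:=\mathrm{sep}(A_{22},A_{11})>0$. Let $R\in\mathbb{C}^{m\times(n-m)}$ be the solution of $A_{11}R-RA_{22}=-A_{12}$, let $p:=\sqrt{1+\|R\|_2^2}$, let $$S:=\begin{bmatrix}I_m&R/p\\ 0&I_{n-m}/p\end{bmatrix},$$ and let $\phi(\epsilon):=(p+\sqrt{p^2-1})\,\epsilon$. Suppose that $$\|E\|_2<\frac{s}{2(p+\sqrt{p^2-1})}=\phi^{-1}(s/2).$$ Then there exists a unique $X\in\mathbb{C}^{(n-m)\times m}$ such that $$\begin{bmatrix}I_m&0\\ X&I_{n-m}\end{bmatrix}^{-1}S^{-1}\begin{bmatrix}A_{11}+E_{11}&A_{12}+E_{12}\\ E_{21}&A_{22}+E_{22}\end{bmatrix}S\begin{bmatrix}I_m&0\\ X&I_{n-m}\end{bmatrix}=\begin{bmatrix}M&\widehat{E}_{12}\\ 0&N\end{bmatrix}.$$ Here $M:=A_{11}+\widehat{E}_{11}+\widehat{E}_{12}X$ and $N:=A_{22}+\widehat{E}_{22}-X\widehat{E}_{12}$, where $\widehat{E}_{11}=E_{11}-RE_{21}$, $\widehat{E}_{21}=pE_{21}$, $\widehat{E}_{12}=\frac1p\left[E_{11}R+E_{12}-R(E_{21}R+E_{22})\right]$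 and $\widehat{E}_{22}=E_{21}R+E_{22}$. Further, $$\|X\|_2\le\frac{2(p+\sqrt{p^2-1})\|E\|_2}{s}.$$ Furthermore, the following assertions hold. (a) $\mathrm{eig}_{\phi(\|E\|_2)}(A_{11})\cap\mathrm{eig}_{\phi(\|E\|_2)}(A_{22})=\emptyset$. (b) $\mathrm{eig}(M)\subset\mathrm{eig}_{\phi(\|E\|_2)}(A_{11})$ and $\mathrm{eig}(N)\subset\mathrm{eig}_{\phi(\|E\|_2)}(A_{22})$. (c) $\left(S\begin{bmatrix}I_m\\ X\end{bmatrix},M\right)$ and $\left((S^{-1})^*\begin{bmatrix}-X^*\\ I_{n-m}\end{bmatrix},N\right)$ are right and left invariant pairs of $A+E$, respectively. (d) Let $\mathcal{X}:=\mathrm{span}\begin{bmatrix}I_m\\ 0\end{bmatrix}$ and $\mathcal{X}_E:=\mathrm{span}\left(S\begin{bmatrix}I_m\\ X\end{bmatrix}\right)$. Then $A\mathcal{X}\subset\mathcal{X}$ and $(A+E)\mathcal{X}_E\subset\mathcal{X}_E$. Further, $$\tan\theta_{\max}(\mathcal{X},\mathcal{X}_E)\le\frac{2(p+\sqrt{p^2-1})^2\|E\|_2}{s}.$$ (e) Let $\mathcal{Y}:=\mathrm{span}\begin{bmatrix}0\\ I_{n-m}\end{bmatrix}$ and $\mathcal{Y}_E:=\mathrm{span}\left((S^{-1})^*\begin{bmatrix}-X^*\\ I_{n-m}\end{bmatrix}\right)$. Then $A^*\mathcal{Y}\subset\mathcal{Y}$ and $(A+E)^*\mathcal{Y}_E\subset\mathcal{Y}_E$.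 Further, $$\tan\theta_{\max}(\mathcal{Y},\mathcal{Y}_E)\le\frac{2(p+\sqrt{p^2-1})^2\|E\|_2}{s}.$$
   Context: $\|\cdot\|_2$ is the spectral norm, $I_k$ is the $k\times k$ identity matrix, $\mathrm{eig}(B)$ is the set of eigenvalues of $B$, $B^*$ is the conjugate transpose, and $\mathrm{span}(B)$ is the column space of $B$. The matrices $A$ and $E$ are partitioned conformably. For $B\in\mathbb{C}^{k\times k}$ and $C\in\mathbb{C}^{q\times q}$, $\mathrm{sep}(B,C):=\min\{\|BY-YC\|_2: Y\in\mathbb{C}^{k\times q},\ \|Y\|_2=1\}$; $\mathrm{sep}(B,C)>0$ if and only if $\mathrm{eig}(B)\cap\mathrm{eig}(C)=\emptyset$, so the Sylvester equation defining $R$ has a unique solution. The number $p$ is the spectral norm of $P=\begin{bmatrix}I_m&-R\\ 0&0\end{bmatrix}$, the spectral projection of $A$ corresponding to $\mathrm{eig}(A_{11})$. For $\epsilon\ge0$ and $B\in\mathbb{C}^{k\times k}$, the $\epsilon$-pseudospectrum is $\mathrm{eig}_\epsilon(B):=\bigcup\{\mathrm{eig}(B+F): F\in\mathbb{C}^{k\times k},\ \|F\|_2\le\epsilon\}$. For $B\in\mathbb{C}^{n\times n}$, $(X_0,M_0)\in\mathbb{C}^{n\times k}\times\mathbb{C}^{k\times k}$ is a right invariant pair of $B$ if $\mathrm{rank}(X_0)=k$ and $BX_0=X_0M_0$; $(Y_0,L_0)\in\mathbb{C}^{n\times k}\times\mathbb{C}^{k\times k}$ is a left invariant pair of $B$ if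 $\mathrm{rank}(Y_0)=k$ and $Y_0^*B=L_0Y_0^*$. For two $k$-dimensional subspaces $\mathcal{U}=\mathrm{span}(U)$, $\mathcal{V}=\mathrm{span}(V)$ of $\mathbb{C}^n$ with $U^*U=V^*V=I_k$, the largest canonical angle $\theta_{\max}(\mathcal{U},\mathcal{V})\in[0,\pi/2]$ is defined by $\cos\theta_{\max}(\mathcal{U},\mathcal{V})=\sigma_{\min}(V^*U)$, where $\sigma_{\min}$ is the smallest singular value.
   Formalization: Uniqueness of X is claimed among solutions of the block triangular equation that also satisfy the stated bound on ‖X‖₂; without the bound it fails, e.g. A=diag(0,1), E=[[0,d],[0,0]], 0<d<1/2, where X=0 and X=1/d both solve it. *)

theory Defs
  imports "HOL-Analysis.Analysis"
begin

text \<open>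
  A \<open>p \<times> q\<close> complex matrix is an element of \<^typ>\<open>complex^'q^'p\<close>. The sizes are the cardinalities of
  the index types, so they are arbitrary positive integers. A \<open>2 \<times> 2\<close> block matrix is indexed by
  sum types: with \<open>CARD('m) = m\<close> and \<open>CARD('k) = n - m\<close> it has size \<open>CARD('m + 'k) = n\<close>.
  The identity matrix is \<^term>\<open>mat 1\<close>; the constant \<open>1\<close> of the vector type is the all-ones matrix.
\<close>

definition block_mat ::
  "'a^'p^'m \<Rightarrow> 'a^'q^'m \<Rightarrow> 'a^'p^'k \<Rightarrow> 'a^'q^'k \<Rightarrow> 'a^('p + 'q)^('m + 'k)" where
  "block_mat A B C D = (\<chi> i j.
     case i of
       Inl a \<Rightarrow> (case j of Inl b \<Rightarrow> A $ a $ b | Inr b \<Rightarrow> B $ a $ b)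
     | Inr a \<Rightarrow> (case j of Inl b \<Rightarrow> C $ a $ b | Inr b \<Rightarrow> D $ a $ b))"

definition block_col :: "'a^'p^'m \<Rightarrow> 'a^'p^'k \<Rightarrow> 'a^'p^('m + 'k)" where
  "block_col A C = (\<chi> i j. case i of Inl a \<Rightarrow> A $ a $ j | Inr a \<Rightarrow> C $ a $ j)"

definition ctranspose :: "complex^'q^'p \<Rightarrow> complex^'p^'q" where
  "ctranspose A = (\<chi> i j. cnj (A $ j $ i))"

definition spectral_norm :: "complex^'q^'p \<Rightarrow> real" where
  "spectral_norm A = onorm (\<lambda>x. A *v x)"

definition eig :: "complex^'k^'k \<Rightarrow> complex set" where
  "eig B = {z. \<exists>v. v \<noteq> 0 \<and> B *v v = z *s v}"

definition pseudospectrum :: "real \<Rightarrow> complex^'k^'k \<Rightarrow> complex set" where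
  "pseudospectrum \<epsilon> B = \<Union> {eig (B + F) | F. spectral_norm F \<le> \<epsilon>}"

text \<open>The infimum is a minimum, since the unit sphere of the spectral norm is compact.\<close>

definition sep :: "complex^'k^'k \<Rightarrow> complex^'q^'q \<Rightarrow> real" where
  "sep B C = Inf {spectral_norm (B ** Y - Y ** C) | Y :: complex^'q^'k. spectral_norm Y = 1}"

definition right_invariant_pair ::
  "complex^'n^'n \<Rightarrow> (complex^'k^'n) \<times> (complex^'k^'k) \<Rightarrow> bool" where
  "right_invariant_pair B = (\<lambda>(X, M). rank X = CARD('k) \<and> B ** X = X ** M)"

definition left_invariant_pair ::
  "complex^'n^'n \<Rightarrow> (complex^'k^'n) \<times> (complex^'k^'k) \<Rightarrow> bool" where
  "left_invariant_pair B =
     (\<lambda>(Y, L). rank Y = CARD('k) \<and> ctranspose Y ** B = L ** ctranspose Y)"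

text \<open>
  The complex span; the unqualified \<open>span\<close> would be the span over the real numbers.
\<close>

definition column_space :: "complex^'q^'p \<Rightarrow> (complex^'p) set" where
  "column_space B = vec.span (columns B)"

definition singular_values :: "complex^'k^'k \<Rightarrow> real set" where
  "singular_values B = {\<sigma>. 0 \<le> \<sigma> \<and> complex_of_real (\<sigma>\<^sup>2) \<in> eig (ctranspose B ** B)}"

definition sigma_min :: "complex^'k^'k \<Rightarrow> real" where
  "sigma_min B = Min (singular_values B)"

text \<open>
  The type argument gives the common dimension \<open>CARD('k)\<close> of the two subspaces. The angle does not
  depend on the choice of the orthonormal bases (the columns of \<open>U\<close> and \<open>V\<close>). It is unspecified if
  one of the two sets is not a subspace of this dimension.
\<close>

definition theta_max :: "'k::finite itself \<Rightarrow> (complex^'n) set \<Rightarrow> (complex^'n) set \<Rightarrow> real" where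
  "theta_max (_ :: 'k itself) \<U> \<V> = (THE \<theta>. 0 \<le> \<theta> \<and> \<theta> \<le> pi / 2 \<and>
     (\<exists>(U :: complex^'k^'n) (V :: complex^'k^'n).
        ctranspose U ** U = mat 1 \<and> ctranspose V ** V = mat 1 \<and>
        column_space U = \<U> \<and> column_space V = \<V> \<and>
        cos \<theta> = sigma_min (ctranspose V ** U)))"

end

theory Submission
  imports Defs "HOL-Computational_Algebra.Fundamental_Theorem_Algebra"
begin

text \<open>
  The columns of \<open>S\<close> block diagonalize \<open>A\<close>: the Sylvester equation for \<open>R\<close> says that
  \<open>S\<^sup>-\<^sup>1 A S = diag(A11, A22)\<close>. With \<open>\<rho> = \<parallel>R\<parallel>\<close> and \<open>\<kappa> = p + \<rho>\<close> the product of the norms of \<open>S\<close> and \<open>S\<^sup>-\<^sup>1\<close> is at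
  most \<open>\<kappa>\<close> (\<open>decoupler_norm_le\<close>), so \<open>F = S\<^sup>-\<^sup>1 E S\<close> satisfies \<open>\<parallel>F\<parallel> \<le> \<phi> = \<kappa> \<parallel>E\<parallel> < s / 2\<close>. What remains is a statement
  about \<open>diag(A11, A22) + F\<close>. Block triangularization by \<open>X\<close> means that the graph of \<open>X\<close> is invariant under
  this matrix, which is the Riccati equation
  \<open>A22 X - X A11 = [X, -I] F [I; X]\<close>.

  Existence. The left hand side is an invertible linear map of \<open>X\<close> whose inverse has norm at most
  \<open>1 / s\<close>, and the right hand side has norm at most \<open>\<phi> (1 + \<parallel>X\<parallel>\<^sup>2)\<close>. Therefore the corresponding fixed
  point map preserves the ball of radius \<open>2 \<phi> / s < 1\<close>, and Brouwer's theorem applies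
  (\<open>riccati_solution_exists\<close>). A contraction argument would need a smaller \<open>\<phi>\<close>.

  Localization. If \<open>(v, X v)\<close> is an eigenvector of \<open>diag(A11, A22) + F\<close> for \<open>z\<close> and \<open>\<parallel>X\<parallel> \<le> 1\<close>, then the residuals
  of \<open>v\<close> and \<open>X v\<close> for \<open>A11 - z\<close> and \<open>A22 - z\<close> are together at most \<open>\<phi> \<parallel>(v, X v)\<parallel>\<close>. The relative residuals add up
  to at least \<open>s\<close> (\<open>sep_le_residuals\<close>), so both cannot be small, and the one of the dominant component
  \<open>v\<close> is at most \<open>\<phi>\<close> (\<open>dominant_block_in_pseudospectrum\<close>). This puts the eigenvalues of \<open>M\<close> into the
  pseudospectrum of \<open>A11\<close>; the adjoint problem does the same for \<open>N\<close> and \<open>A22\<close>. The same inequality for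
  \<open>s\<close> shows that the two pseudospectra are disjoint.

  Uniqueness. The difference \<open>D\<close> of two solutions \<open>X\<close>, \<open>Y\<close> satisfies \<open>N(Y) D = D M(X)\<close>. The spectra of \<open>N(Y)\<close> and \<open>M(X)\<close>
  are disjoint by localization, hence \<open>D = 0\<close> (\<open>sylvester_homogeneous_unique\<close>).

  Angles. After identification of the smallest singular value of \<open>V\<^sup>* U\<close> with the smallest norm of a
  projected unit vector, the angle between a coordinate subspace and the graph-like column space of
  \<open>[W; V]\<close> has a tangent bounded by the quotients \<open>\<parallel>V u\<parallel> / \<parallel>W u\<parallel>\<close> (\<open>tan_theta_max_graph_le\<close>). In both cases
  these quotients are at most \<open>\<parallel>X\<parallel> / (p - \<rho> \<parallel>X\<parallel>) \<le> \<kappa> \<parallel>X\<parallel>\<close>, because \<open>\<parallel>X\<parallel> \<le> 1\<close> and \<open>p - \<rho> = 1 / \<kappa>\<close>.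
\<close>

section \<open>The complex inner product and adjoint matrices\<close>

definition cinner :: "complex^'n \<Rightarrow> complex^'n \<Rightarrow> complex" where
  "cinner x y = (\<Sum>i\<in>UNIV. cnj (x $ i) * y $ i)"

definition outer :: "complex^'p \<Rightarrow> complex^'q \<Rightarrow> complex^'q^'p" where
  "outer x y = (\<chi> i j. x $ i * cnj (y $ j))"

lemma inner_eq_Re_cinner: "x \<bullet> y = Re (cinner x y)" for x y :: "complex^'n"
  by (simp add: inner_vec_def cinner_def inner_complex_def)

lemma cinner_cnj: "cnj (cinner x y) = cinner y x"
  by (simp add: cinner_def mult.commute)

lemma cinner_add_right: "cinner x (y + z) = cinner x y + cinner x z"
  by (simp add: cinner_def algebra_simps sum.distrib)

lemma cinner_diff_right: "cinner x (y - z) = cinner x y - cinner x z"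
  by (simp add: cinner_def algebra_simps sum_subtractf)

lemma cinner_smult_left: "cinner (c *s x) y = cnj c * cinner x y"
  by (simp add: cinner_def sum_distrib_left mult.assoc)

lemma cinner_smult_right: "cinner x (c *s y) = c * cinner x y"
  by (simp add: cinner_def sum_distrib_left mult_ac)

lemma cinner_zero [simp]: "cinner 0 x = 0" "cinner x 0 = 0"
  by (simp_all add: cinner_def)

lemma cinner_sum_right: "cinner x (sum f I) = (\<Sum>i\<in>I. cinner x (f i))"
  by (induction I rule: infinite_finite_induct) (simp_all add: cinner_add_right)

lemma cinner_self: "cinner x x = complex_of_real ((norm x)\<^sup>2)"
proof -
  have "Im (cinner x x) = 0"
    by (simp add: cinner_def mult.commute)
  moreover have "Re (cinner x x) = (norm x)\<^sup>2"
    by (simp flip: inner_eq_Re_cinner add: power2_norm_eq_inner)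
  ultimately show ?thesis
    by (simp add: complex_eq_iff)
qed

lemma norm_smult: "norm (c *s x) = cmod c * norm x" for x :: "complex^'n"
  by (simp add: norm_vec_def norm_mult L2_set_right_distrib)

lemma of_real_smult: "complex_of_real r *s x = r *\<^sub>R x" for x :: "complex^'n"
  by (simp add: vec_eq_iff scaleR_conv_of_real[where 'a = complex])

lemma norm_axis: "norm (axis i a) = norm a" for a :: complex
  by (simp add: norm_eq_sqrt_inner inner_axis_axis)

text \<open>Cauchy-Schwarz for the complex inner product follows from the real one after a rotation
  of \<open>x\<close> that makes the inner product real.\<close>

lemma cmod_cinner_le: "cmod (cinner x y) \<le> norm x * norm y"
proof (cases "cinner x y = 0")
  case False
  define c where "c = cinner x y / cmod (cinner x y)"
  have c: "cmod c = 1" "cnj c * cinner x y = cmod (cinner x y)"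
    using False complex_norm_square[of "cinner x y"]
    by (simp_all add: c_def norm_divide power2_eq_square mult.commute[of "cnj _"] divide_simps)
  then have "cmod (cinner x y) = (c *s x) \<bullet> y"
    by (simp add: inner_eq_Re_cinner cinner_smult_left)
  also have "\<dots> \<le> norm x * norm y"
    using norm_cauchy_schwarz[of "c *s x" y] by (simp add: norm_smult c)
  finally show ?thesis .
qed simp

lemma ctranspose_ctranspose [simp]: "ctranspose (ctranspose B) = B"
  by (simp add: ctranspose_def vec_eq_iff)

lemma ctranspose_mult: "ctranspose (A ** B) = ctranspose B ** ctranspose A"
  by (simp add: ctranspose_def vec_eq_iff matrix_matrix_mult_def mult.commute)

lemma ctranspose_add: "ctranspose (A + B) = ctranspose A + ctranspose B"
  by (simp add: ctranspose_def vec_eq_iff)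

lemma ctranspose_diff: "ctranspose (A - B) = ctranspose A - ctranspose B"
  by (simp add: ctranspose_def vec_eq_iff)

lemma ctranspose_uminus: "ctranspose (- A) = - ctranspose A"
  by (simp add: ctranspose_def vec_eq_iff)

lemma ctranspose_scaleR: "ctranspose (r *\<^sub>R A) = r *\<^sub>R ctranspose A"
  by (simp add: ctranspose_def vec_eq_iff)

lemma ctranspose_zero [simp]: "ctranspose 0 = 0"
  by (simp add: ctranspose_def vec_eq_iff)

lemma ctranspose_mat [simp]: "ctranspose (mat 1) = mat 1"
  by (simp add: ctranspose_def vec_eq_iff mat_def)

lemma cinner_ctranspose: "cinner (ctranspose B *v x) y = cinner x (B *v y)"
  unfolding cinner_def ctranspose_def matrix_vector_mult_def
  by (simp add: sum_distrib_left sum_distrib_right mult_ac) (subst sum.swap, rule refl)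

lemma inner_ctranspose: "(ctranspose B *v x) \<bullet> y = x \<bullet> (B *v y)"
  by (simp add: inner_eq_Re_cinner cinner_ctranspose)

lemma outer_vector_mult: "outer x y *v z = cinner y z *s x"
  by (simp add: outer_def matrix_vector_mult_def cinner_def vec_eq_iff sum_distrib_right
      sum_distrib_left mult_ac)

lemma mult_outer: "A ** outer x y = outer (A *v x) y"
  by (simp add: outer_def matrix_vector_mult_def matrix_matrix_mult_def vec_eq_iff
      sum_distrib_right mult.assoc)

lemma outer_mult: "outer x y ** A = outer x (ctranspose A *v y)"
  by (simp add: outer_def matrix_vector_mult_def matrix_matrix_mult_def vec_eq_iff ctranspose_def
      sum_distrib_left mult_ac)

lemma uminus_matrix_vector_mult: "(- A) *v x = - (A *v x)" for A :: "complex^'q^'p"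
  by (metis add.inverse_inverse diff_0 matrix_vector_mult_0 matrix_vector_mult_diff_rdistrib)

lemma scaleR_matrix_vector_mult: "(r *\<^sub>R A) *v x = r *\<^sub>R (A *v x)" for A :: "complex^'q^'p"
  by (simp add: matrix_vector_mult_def vec_eq_iff scaleR_sum_right)

lemma matrix_vector_mult_scaleR_complex: "A *v (r *\<^sub>R x) = r *\<^sub>R (A *v x)" for A :: "complex^'q^'p"
  by (simp add: matrix_vector_mult_def vec_eq_iff scaleR_sum_right)

lemma matrix_add_rdistrib: "(A + B) ** C = A ** C + B ** C" for A :: "complex^'q^'p"
  by (simp add: matrix_eq matrix_vector_mul_assoc[symmetric] algebra_simps)

lemma matrix_mult_diff_right: "A ** (B - C) = A ** B - A ** C" for A :: "complex^'q^'p"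
  by (simp add: matrix_eq matrix_vector_mul_assoc[symmetric] algebra_simps)

lemma matrix_mult_diff_left: "(A - B) ** C = A ** C - B ** C" for A :: "complex^'q^'p"
  by (simp add: matrix_eq matrix_vector_mul_assoc[symmetric] algebra_simps)

lemma matrix_mult_uminus_right: "A ** (- B) = - (A ** B)" for A :: "complex^'q^'p"
  using matrix_mult_diff_right[of A 0 B] by simp

lemma matrix_mult_uminus_left: "(- A) ** B = - (A ** B)" for A :: "complex^'q^'p"
  using matrix_mult_diff_left[of 0 A B] by simp

lemma matrix_mult_scaleR_right: "A ** (r *\<^sub>R B) = r *\<^sub>R (A ** B)" for A :: "complex^'q^'p"
  by (metis matrix_scalar_ac scalar_matrix_assoc)

lemma matrix_mult_scaleR_left: "(r *\<^sub>R A) ** B = r *\<^sub>R (A ** B)" for A :: "complex^'q^'p"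
  by (metis scalar_matrix_assoc)

text \<open>A left inverse of a square matrix is also a right inverse. If the adjoint were injective, the adjoint
  of its left inverse would therefore be a left inverse of \<open>B\<close>.\<close>

lemma ctranspose_singular:
  fixes B :: "complex^'n^'n"
  assumes "v \<noteq> 0" "B *v v = 0"
  obtains u where "u \<noteq> 0" "ctranspose B *v u = 0"
proof -
  have "\<exists>u. u \<noteq> 0 \<and> ctranspose B *v u = 0"
  proof (rule ccontr)
    assume "\<not> ?thesis"
    then obtain C where "C ** ctranspose B = mat 1"
      using matrix_left_invertible_ker[of "ctranspose B"] by blast
    then have "B ** ctranspose C = mat 1"
      by (metis ctranspose_ctranspose ctranspose_mat ctranspose_mult)
    then have "ctranspose C ** B = mat 1"
      by (simp add: matrix_left_right_inverse)
    then have "v = ctranspose C *v (B *v v)"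
      by (simp add: matrix_vector_mul_assoc)
    with assms show False by simp
  qed
  with that show ?thesis by blast
qed

lemma mat_shift_mult: "(B - mat z) *v v = B *v v - z *s v" for B :: "complex^'n^'n"
proof -
  have "mat z *v v = z *s v"
    by (simp add: matrix_vector_mult_def mat_def vec_eq_iff if_distrib if_distribR cong: if_cong)
  then show ?thesis by (simp add: matrix_vector_mult_diff_rdistrib)
qed

lemma ctranspose_mat_cnj: "ctranspose (mat z) = mat (cnj z)"
  by (simp add: ctranspose_def vec_eq_iff mat_def)

lemma ctranspose_eigenvector:
  fixes B :: "complex^'n^'n"
  assumes "v \<noteq> 0" "B *v v = z *s v"
  obtains u where "u \<noteq> 0" "ctranspose B *v u = cnj z *s u"
proof -
  obtain u where "u \<noteq> 0" "ctranspose (B - mat z) *v u = 0"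
    using ctranspose_singular[of v "B - mat z"] assms by (auto simp: mat_shift_mult)
  then show ?thesis
    by (intro that[of u]) (simp_all add: ctranspose_diff ctranspose_mat_cnj mat_shift_mult)
qed

section \<open>Spectral norm, separation and pseudospectra\<close>

lemma norm_mult_le_spectral_norm: "norm (B *v x) \<le> spectral_norm B * norm x"
  unfolding spectral_norm_def by (rule onorm) simp

lemma spectral_norm_le: "(\<And>x. norm (B *v x) \<le> b * norm x) \<Longrightarrow> spectral_norm B \<le> b"
  unfolding spectral_norm_def by (rule onorm_le)

lemma spectral_norm_nonneg [simp]: "0 \<le> spectral_norm B"
  unfolding spectral_norm_def by (rule onorm_pos_le) simp

lemma spectral_norm_eq_0: "spectral_norm B = 0 \<longleftrightarrow> B = 0"
  unfolding spectral_norm_def by (subst onorm_eq_0) (simp_all add: matrix_eq)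

lemma spectral_norm_le_iff: "spectral_norm B \<le> b \<longleftrightarrow> (\<forall>x. norm (B *v x) \<le> b * norm x)"
proof
  assume "spectral_norm B \<le> b"
  then show "\<forall>x. norm (B *v x) \<le> b * norm x"
    using norm_mult_le_spectral_norm by (meson mult_right_mono norm_ge_zero order_trans)
qed (auto intro: spectral_norm_le)

lemma spectral_norm_scaleR: "spectral_norm (r *\<^sub>R B) = \<bar>r\<bar> * spectral_norm B"
proof -
  have "(*v) (r *\<^sub>R B) = (\<lambda>x. r *\<^sub>R (B *v x))"
    by (simp add: fun_eq_iff scaleR_matrix_vector_mult)
  then show ?thesis
    by (simp add: spectral_norm_def onorm_scaleR)
qed

text \<open>With \<open>y = B\<^sup>* x\<close>, moving \<open>B\<^sup>*\<close> to the other side gives \<open>\<parallel>y\<parallel>\<^sup>2 = x \<bullet> B y \<le> \<parallel>x\<parallel> \<parallel>B\<parallel> \<parallel>y\<parallel>\<close>.\<close>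

lemma spectral_norm_ctranspose_le: "spectral_norm (ctranspose B) \<le> spectral_norm B"
proof (rule spectral_norm_le)
  fix x
  let ?y = "ctranspose B *v x"
  have "(norm ?y)\<^sup>2 = x \<bullet> (B *v ?y)"
    by (simp add: power2_norm_eq_inner inner_ctranspose)
  also have "\<dots> \<le> norm x * (spectral_norm B * norm ?y)"
    by (meson mult_left_mono norm_cauchy_schwarz norm_ge_zero norm_mult_le_spectral_norm order_trans)
  finally show "norm ?y \<le> spectral_norm B * norm x"
    by (cases "?y = 0") (simp_all add: power2_eq_square mult_ac)
qed

lemma spectral_norm_ctranspose [simp]: "spectral_norm (ctranspose B) = spectral_norm B"
  by (metis antisym ctranspose_ctranspose spectral_norm_ctranspose_le)

lemma spectral_norm_outer: "spectral_norm (outer x y) = norm x * norm y"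
proof (rule antisym)
  show "spectral_norm (outer x y) \<le> norm x * norm y"
  proof (rule spectral_norm_le)
    fix z
    show "norm (outer x y *v z) \<le> norm x * norm y * norm z"
      using mult_right_mono[OF cmod_cinner_le[of y z] norm_ge_zero[of x]]
      by (simp add: outer_vector_mult norm_smult mult_ac)
  qed
  show "norm x * norm y \<le> spectral_norm (outer x y)"
    using norm_mult_le_spectral_norm[of "outer x y" y]
    by (cases "y = 0")
       (simp_all add: outer_vector_mult norm_smult cinner_self power2_eq_square norm_mult mult_ac)
qed

lemma sep_mult_le: "sep B C * spectral_norm Y \<le> spectral_norm (B ** Y - Y ** C)"
proof (cases "Y = 0")
  case True
  then show ?thesis by (simp add: spectral_norm_eq_0[THEN iffD2])
next
  case False
  define y where "y = spectral_norm Y"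
  have y: "y > 0"
    using False by (simp add: y_def spectral_norm_eq_0 less_le)
  define Z where "Z = (1 / y) *\<^sub>R Y"
  have "spectral_norm Z = 1"
    using y by (simp add: Z_def spectral_norm_scaleR flip: y_def)
  then have "sep B C \<le> spectral_norm (B ** Z - Z ** C)"
    unfolding sep_def by (intro cInf_lower bdd_belowI[of _ 0]) auto
  also have "B ** Z - Z ** C = (1 / y) *\<^sub>R (B ** Y - Y ** C)"
    by (simp add: Z_def matrix_mult_scaleR_right matrix_mult_scaleR_left scaleR_diff_right)
  also have "spectral_norm \<dots> = spectral_norm (B ** Y - Y ** C) / y"
    unfolding spectral_norm_scaleR using y by simp
  finally show ?thesis
    using y by (simp add: y_def[symmetric] pos_le_divide_eq)
qed

text \<open>A residual \<open>r = z v - B v\<close> is absorbed by the rank-one perturbation \<open>r v\<^sup>* / \<parallel>v\<parallel>\<^sup>2\<close>, whose spectral norm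
  is \<open>\<parallel>r\<parallel> / \<parallel>v\<parallel>\<close>.\<close>

lemma pseudospectrum_iff:
  fixes B :: "complex^'n^'n"
  shows "z \<in> pseudospectrum \<epsilon> B \<longleftrightarrow> (\<exists>v. v \<noteq> 0 \<and> norm (B *v v - z *s v) \<le> \<epsilon> * norm v)"
proof
  assume "z \<in> pseudospectrum \<epsilon> B"
  then obtain F v where F: "spectral_norm F \<le> \<epsilon>" "v \<noteq> 0" "(B + F) *v v = z *s v"
    by (auto simp: pseudospectrum_def eig_def)
  then have "B *v v - z *s v = - (F *v v)"
    by (simp add: matrix_vector_mult_add_rdistrib algebra_simps)
  then have "norm (B *v v - z *s v) \<le> \<epsilon> * norm v"
    using F(1) by (simp add: spectral_norm_le_iff)
  then show "\<exists>v. v \<noteq> 0 \<and> norm (B *v v - z *s v) \<le> \<epsilon> * norm v"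
    using F(2) by blast
next
  assume "\<exists>v. v \<noteq> 0 \<and> norm (B *v v - z *s v) \<le> \<epsilon> * norm v"
  then obtain v where v: "v \<noteq> 0" "norm (B *v v - z *s v) \<le> \<epsilon> * norm v" by blast
  define r where "r = z *s v - B *v v"
  define F where "F = (1 / (norm v)\<^sup>2) *\<^sub>R outer r v"
  have "F *v v = r"
    using v(1) by (simp add: F_def scaleR_matrix_vector_mult outer_vector_mult cinner_self
        of_real_smult del: of_real_power)
  then have "(B + F) *v v = z *s v"
    by (simp add: matrix_vector_mult_add_rdistrib r_def)
  moreover have "spectral_norm F \<le> \<epsilon>"
    using v unfolding F_def r_def
    by (simp add: spectral_norm_scaleR spectral_norm_outer norm_minus_commute power2_eq_square field_simps)
  ultimately show "z \<in> pseudospectrum \<epsilon> B"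
    using v(1) by (auto simp: pseudospectrum_def eig_def)
qed

lemma pseudospectrum_ctranspose:
  assumes "z \<in> pseudospectrum \<epsilon> B"
  shows "cnj z \<in> pseudospectrum \<epsilon> (ctranspose B)"
proof -
  obtain F v where F: "spectral_norm F \<le> \<epsilon>" "v \<noteq> 0" "(B + F) *v v = z *s v"
    using assms by (auto simp: pseudospectrum_def eig_def)
  obtain u where "u \<noteq> 0" "ctranspose (B + F) *v u = cnj z *s u"
    using ctranspose_eigenvector F by blast
  then have "cnj z \<in> eig (ctranspose B + ctranspose F)"
    by (auto simp: eig_def ctranspose_add)
  moreover have "spectral_norm (ctranspose F) \<le> \<epsilon>"
    using F by simp
  ultimately show ?thesis
    unfolding pseudospectrum_def by blast
qed

lemma eig_ctranspose: "cnj z \<in> eig (ctranspose B)" if "z \<in> eig B"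
  using that ctranspose_eigenvector unfolding eig_def by blast

text \<open>An approximate right eigenvector \<open>w\<close> of \<open>B\<close> and an approximate left eigenvector \<open>u\<close> of \<open>C\<close> for the
  same \<open>z\<close> give the test matrix \<open>w u\<^sup>*\<close> in the definition of \<^const>\<open>sep\<close>, because
  \<open>B w u\<^sup>* - w u\<^sup>* C = (B w - z w) u\<^sup>* - w (C\<^sup>* u - cnj z u)\<^sup>*\<close>. The pseudospectra of \<open>C\<close> and \<open>C\<^sup>*\<close> are
  conjugate, so \<open>u\<close> can be obtained from a right vector \<open>v\<close> with the same residual.\<close>

lemma sep_le_residuals:
  assumes "w \<noteq> 0" "norm (B *v w - z *s w) \<le> b * norm w"
    and "v \<noteq> 0" "norm (C *v v - z *s v) \<le> c * norm v"
  shows "sep B C \<le> b + c"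
proof -
  have "z \<in> pseudospectrum c C"
    using assms pseudospectrum_iff by blast
  from pseudospectrum_ctranspose[OF this] obtain u where
    u: "u \<noteq> 0" "norm (ctranspose C *v u - cnj z *s u) \<le> c * norm u"
    by (auto simp: pseudospectrum_iff)
  let ?Y = "outer w u"
  \<comment> \<open>The terms with \<open>z\<close> cancel.\<close>
  have eq: "(B ** ?Y - ?Y ** C) *v x = (outer (B *v w - z *s w) u) *v x - (outer w (ctranspose C *v u - cnj z *s u)) *v x" for x
    by (simp add: mult_outer outer_mult matrix_vector_mult_diff_rdistrib outer_vector_mult)
       (simp add: vec_eq_iff cinner_def algebra_simps sum_subtractf sum_distrib_left sum_distrib_right)
  have "spectral_norm (B ** ?Y - ?Y ** C) \<le> (b + c) * (norm w * norm u)"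
  proof (rule spectral_norm_le)
    fix x
    have "norm ((B ** ?Y - ?Y ** C) *v x) \<le> norm (outer (B *v w - z *s w) u *v x)
        + norm (outer w (ctranspose C *v u - cnj z *s u) *v x)"
      unfolding eq by (rule norm_triangle_ineq4)
    also have "\<dots> \<le> (b * norm w) * norm u * norm x + norm w * (c * norm u) * norm x"
      using assms(2) u(2)
      by (intro add_mono order_trans[OF norm_mult_le_spectral_norm] mult_right_mono)
         (auto simp: spectral_norm_outer intro!: mult_right_mono mult_left_mono)
    finally show "norm ((B ** ?Y - ?Y ** C) *v x) \<le> (b + c) * (norm w * norm u) * norm x"
      by (simp add: algebra_simps)
  qed
  then have "sep B C * (norm w * norm u) \<le> (b + c) * (norm w * norm u)"
    using sep_mult_le[of B C ?Y] by (simp add: spectral_norm_outer)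
  then show ?thesis
    using assms(1) u(1) by simp
qed

text \<open>Taking adjoints turns \<open>B\<^sup>* Y - Y C\<^sup>*\<close> into \<open>- (C Y\<^sup>* - Y\<^sup>* B)\<close>.\<close>

lemma sep_ctranspose_le: "sep C B \<le> sep (ctranspose B) (ctranspose C)"
  for B :: "complex^'m^'m" and C :: "complex^'k^'k"
proof -
  obtain e :: "complex^'k^'m" where "spectral_norm e = 1"
  proof
    show "spectral_norm (outer (axis undefined 1) (axis undefined 1) :: complex^'k^'m) = 1"
      by (simp add: spectral_norm_outer norm_axis)
  qed
  then show ?thesis
    unfolding sep_def[of "ctranspose B" "ctranspose C"]
  proof (intro cInf_greatest, blast, clarsimp)
    fix Y :: "complex^'k^'m" assume "spectral_norm Y = 1"
    then have "sep C B \<le> spectral_norm (C ** ctranspose Y - ctranspose Y ** B)"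
      using sep_mult_le[of C B "ctranspose Y"] by simp
    also have "C ** ctranspose Y - ctranspose Y ** B
        = ctranspose ((- 1) *\<^sub>R (ctranspose B ** Y - Y ** ctranspose C))"
      by (simp add: ctranspose_diff ctranspose_mult ctranspose_uminus)
    also have "spectral_norm \<dots> = spectral_norm (ctranspose B ** Y - Y ** ctranspose C)"
      unfolding spectral_norm_ctranspose spectral_norm_scaleR by simp
    finally show "sep C B \<le> spectral_norm (ctranspose B ** Y - Y ** ctranspose C)" .
  qed
qed

lemma pseudospectra_disjoint:
  assumes "2 * \<epsilon> < sep B C"
  shows "pseudospectrum \<epsilon> B \<inter> pseudospectrum \<epsilon> C = {}"
  using sep_le_residuals[of _ B _ \<epsilon> _ C \<epsilon>] assms by (fastforce simp: pseudospectrum_iff)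

text \<open>Suppose that \<open>(v, w)\<close> is an approximate eigenvector of the block diagonal matrix with blocks \<open>B\<close>, \<open>C\<close>,
  and let \<open>a\<close>, \<open>b\<close> be the relative residuals of \<open>v\<close> and \<open>w\<close>. The hypothesis says that a weighted mean of
  \<open>a\<^sup>2\<close> and \<open>b\<^sup>2\<close> is at most \<open>\<phi>\<^sup>2\<close>, with the larger weight on \<open>a\<^sup>2\<close>. If \<open>a > \<phi>\<close>, then replacing the weights
  by equal ones gives \<open>a\<^sup>2 + b\<^sup>2 \<le> 2 \<phi>\<^sup>2\<close>. But \<open>a + b \<ge> sep C B > 2 \<phi>\<close> forces \<open>a\<^sup>2 + b\<^sup>2 > 2 \<phi>\<^sup>2\<close>. This
  localizes the eigenvalues without losing a factor for the off-diagonal blocks of the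
  perturbation.\<close>

lemma dominant_block_in_pseudospectrum:
  assumes sep: "2 * \<phi> < sep C B" and "0 \<le> \<phi>"
    and "v \<noteq> 0" "norm w \<le> norm v"
    and res: "(norm (B *v v - z *s v))\<^sup>2 + (norm (C *v w - z *s w))\<^sup>2
              \<le> \<phi>\<^sup>2 * ((norm v)\<^sup>2 + (norm w)\<^sup>2)"
  shows "z \<in> pseudospectrum \<phi> B"
proof (rule ccontr)
  assume "z \<notin> pseudospectrum \<phi> B"
  then have far: "norm (B *v v - z *s v) > \<phi> * norm v"
    using \<open>v \<noteq> 0\<close> by (auto simp: pseudospectrum_iff not_le)
  define a where "a = norm (B *v v - z *s v) / norm v"
  define b where "b = norm (C *v w - z *s w) / norm w"
  have v: "norm (B *v v - z *s v) = a * norm v"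
    using \<open>v \<noteq> 0\<close> by (simp add: a_def)
  have "a > \<phi>"
    using far \<open>v \<noteq> 0\<close> by (simp add: a_def field_simps)
  then have a: "a\<^sup>2 > \<phi>\<^sup>2"
    using \<open>0 \<le> \<phi>\<close> by (simp add: power_strict_mono)
  have w0: "w \<noteq> 0"
  proof
    assume "w = 0"
    then have "a\<^sup>2 * (norm v)\<^sup>2 \<le> \<phi>\<^sup>2 * (norm v)\<^sup>2"
      using res by (simp add: v power_mult_distrib)
    with a \<open>v \<noteq> 0\<close> show False by simp
  qed
  then have w: "norm (C *v w - z *s w) = b * norm w"
    by (simp add: b_def)
  have "2 * \<phi> < a + b"
    using sep sep_le_residuals[of w C z b v B a] w0 \<open>v \<noteq> 0\<close> v w by simp
  then have "(2 * \<phi>)\<^sup>2 < (a + b)\<^sup>2"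
    using \<open>0 \<le> \<phi>\<close> by (intro power_strict_mono) auto
  also have "(a + b)\<^sup>2 \<le> 2 * (a\<^sup>2 + b\<^sup>2)"
    using zero_le_power2[of "a - b"] by (simp add: power2_eq_square algebra_simps)
  finally have "2 * \<phi>\<^sup>2 < a\<^sup>2 + b\<^sup>2"
    by (simp add: power2_eq_square)
  then have "(\<phi>\<^sup>2 - b\<^sup>2) * (norm w)\<^sup>2 \<le> (a\<^sup>2 - \<phi>\<^sup>2) * (norm w)\<^sup>2 - (a\<^sup>2 + b\<^sup>2 - 2 * \<phi>\<^sup>2) * (norm w)\<^sup>2"
    by (simp add: algebra_simps)
  also have "\<dots> < (a\<^sup>2 - \<phi>\<^sup>2) * (norm w)\<^sup>2"
    using \<open>2 * \<phi>\<^sup>2 < a\<^sup>2 + b\<^sup>2\<close> w0 by simp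
  also have "\<dots> \<le> (a\<^sup>2 - \<phi>\<^sup>2) * (norm v)\<^sup>2"
    using a \<open>norm w \<le> norm v\<close> by (intro mult_left_mono power_mono) auto
  finally show False
    using res by (simp add: v w power_mult_distrib algebra_simps)
qed

section \<open>Matrices that intertwine disjoint spectra\<close>

text \<open>The vector \<open>p(M) v\<close>, evaluated by Horner's scheme.\<close>

definition poly_act :: "complex^'n^'n \<Rightarrow> complex poly \<Rightarrow> complex^'n \<Rightarrow> complex^'n" where
  "poly_act M p v = fold_coeffs (\<lambda>a x. a *s v + M *v x) p 0"

lemma poly_act_0 [simp]: "poly_act M 0 v = 0"
  by (simp add: poly_act_def)

lemma poly_act_pCons [simp]: "poly_act M (pCons a p) v = a *s v + M *v poly_act M p v"
  by (cases "a = 0 \<and> p = 0") (auto simp: poly_act_def)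

lemma poly_act_add: "poly_act M (p + q) v = poly_act M p v + poly_act M q v"
  by (induction p q rule: poly_induct2) (simp_all add: algebra_simps)

lemma poly_act_smult: "poly_act M (smult c p) v = c *s poly_act M p v"
  by (induction p) (simp_all add: vector_add_ldistrib vector_smult_assoc vector_scalar_commute)

lemma poly_act_shift:
  "poly_act M p (M *v v - z *s v) = M *v poly_act M p v - z *s poly_act M p v"
proof (induction p)
  case (pCons a p)
  show ?case
    unfolding poly_act_pCons pCons.IH
    by (simp add: vector_add_ldistrib vector_ssub_ldistrib vector_smult_assoc
        vector_scalar_commute algebra_simps)
qed simp

lemma poly_act_linear_factor:
  "poly_act M ([:- z, 1:] * p) v = M *v poly_act M p v - z *s poly_act M p v"
proof -
  have "[:- z, 1:] * p = pCons 0 p + smult (- z) p"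
    by simp
  then show ?thesis
    by (simp only: poly_act_add poly_act_smult poly_act_pCons)
       (simp add: vec_eq_iff)
qed

lemma poly_act_sum_monom:
  "poly_act M (\<Sum>i\<in>I. monom (c i) i) v = (\<Sum>i\<in>I. c i *s (((*v) M) ^^ i) v)"
proof -
  have monom: "poly_act M (monom a i) v = a *s (((*v) M) ^^ i) v" for a i
    by (induction i) (simp_all add: monom_0 monom_Suc vector_scalar_commute)
  show ?thesis
    by (induction I rule: infinite_finite_induct) (simp_all add: poly_act_add monom)
qed

text \<open>The \<open>CARD('n) + 1\<close> vectors \<open>v, M v, M\<^sup>2 v, \<dots>\<close> are linearly dependent; the coefficients of a
  dependence are those of the polynomial.\<close>

lemma annihilating_polynomial_exists:
  fixes M :: "complex^'n^'n"
  obtains p where "p \<noteq> 0" "poly_act M p v = 0"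
proof -
  define f where "f = (\<lambda>i. (((*v) M) ^^ i) v)"
  define I where "I = {..CARD('n)}"
  have "\<exists>c i. i \<in> I \<and> c i \<noteq> 0 \<and> (\<Sum>i\<in>I. c i *s f i) = 0"
  proof (cases "inj_on f I")
    case True
    have "vec.dependent (f ` I)"
    proof (rule ccontr)
      assume "\<not> vec.dependent (f ` I)"
      then have "card (f ` I) \<le> vec.dim (UNIV :: (complex^'n) set)"
        by (intro vec.independent_card_le_dim) auto
      moreover have "card (f ` I) = Suc CARD('n)"
        by (subst card_image[OF True]) (simp add: I_def)
      ultimately show False
        by (simp add: card_cart_basis)
    qed
    then obtain u i where "i \<in> I" "u (f i) \<noteq> 0" "(\<Sum>x\<in>f ` I. u x *s x) = 0"
      by (auto simp: vec.dependent_finite I_def)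
    then show ?thesis
      by (intro exI[of _ "u \<circ> f"] exI[of _ i]) (simp add: sum.reindex[OF True])
  next
    case False
    then obtain i j where ij: "i \<in> I" "j \<in> I" "i \<noteq> j" "f i = f j"
      by (auto simp: inj_on_def)
    define c :: "nat \<Rightarrow> complex" where "c = (\<lambda>k. if k = i then 1 else if k = j then - 1 else 0)"
    have "(\<Sum>k\<in>I. c k *s f k) = (\<Sum>k\<in>I. (if k = i then f i else 0) + (if k = j then - f j else 0))"
      using ij by (intro sum.cong) (auto simp: c_def simp flip: vector_sneg_minus1)
    also have "\<dots> = 0"
      using ij by (simp add: sum.distrib I_def)
    finally show ?thesis
      using ij by (intro exI[of _ c] exI[of _ i]) (simp add: c_def)
  qed
  then obtain c i where c: "i \<in> I" "c i \<noteq> 0" "(\<Sum>i\<in>I. c i *s f i) = 0"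
    by blast
  define p where "p = (\<Sum>i\<in>I. monom (c i) i)"
  have "coeff p i = c i"
    using c(1) by (simp add: p_def coeff_sum I_def if_distrib cong: if_cong)
  then show ?thesis
    using c by (intro that[of p]) (auto simp: p_def poly_act_sum_monom f_def)
qed

text \<open>Assume \<open>D \<noteq> 0\<close>. Among all nonzero polynomials \<open>q\<close> and vectors \<open>v\<close> with \<open>q(M) v = 0\<close> and \<open>D v \<noteq> 0\<close> choose
  a pair with \<open>q\<close> of least degree, and let \<open>z\<close> be a root, \<open>q = (x - z) r\<close>. By minimality \<open>r(M) v \<noteq> 0\<close>, so
  this vector is an eigenvector of \<open>M\<close> for \<open>z\<close>. On the other hand \<open>r(M)\<close> annihilates \<open>(M - z) v\<close>, so
  minimality gives \<open>D (M - z) v = 0\<close>, that is \<open>(N - z) D v = 0\<close>. Hence \<open>z\<close> is a common eigenvalue.\<close>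

lemma sylvester_homogeneous_unique:
  fixes M :: "complex^'m^'m" and N :: "complex^'k^'k" and D :: "complex^'m^'k"
  assumes intertwine: "N ** D = D ** M" and disjoint: "eig M \<inter> eig N = {}"
  shows "D = 0"
proof (rule ccontr)
  assume "D \<noteq> 0"
  then obtain v0 where v0: "D *v v0 \<noteq> 0"
    by (auto simp: matrix_eq)
  define Q where
    "Q = (\<lambda>d. \<exists>q v. q \<noteq> 0 \<and> degree q = d \<and> D *v v \<noteq> 0 \<and> poly_act M q v = 0)"
  obtain q0 where "q0 \<noteq> 0" "poly_act M q0 v0 = 0"
    by (rule annihilating_polynomial_exists)
  then have "Q (degree q0)"
    using v0 by (auto simp: Q_def)
  define d where "d = (LEAST d. Q d)"
  have "Q d" and least: "\<And>d'. d' < d \<Longrightarrow> \<not> Q d'"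
    unfolding d_def using \<open>Q (degree q0)\<close> by (auto intro: LeastI dest: not_less_Least)
  then obtain q v where q: "q \<noteq> 0" "degree q = d" and v: "D *v v \<noteq> 0" "poly_act M q v = 0"
    by (auto simp: Q_def)
  have "degree q \<noteq> 0"
  proof
    assume "degree q = 0"
    then obtain a where "q = [:a:]"
      using degree_eq_zeroE by blast
    with q v show False by auto
  qed
  then obtain z where "poly q z = 0"
    using fundamental_theorem_of_algebra[of q] by (auto simp: constant_degree)
  then obtain r where r: "q = [:- z, 1:] * r"
    by (auto simp: poly_eq_0_iff_dvd)
  with q have "r \<noteq> 0" by auto
  then have "degree r < d"
    using q(2) degree_mult_eq[of "[:- z, 1:]" r] unfolding r by simp
  then have minimal: "poly_act M r x \<noteq> 0" if "D *v x \<noteq> 0" for x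
    using least \<open>r \<noteq> 0\<close> that by (auto simp: Q_def)
  define w where "w = poly_act M r v"
  have "M *v w - z *s w = 0"
    using v(2) unfolding r poly_act_linear_factor w_def .
  then have "M *v w = z *s w" "w \<noteq> 0"
    using minimal[OF v(1)] by (auto simp: w_def)
  then have "z \<in> eig M"
    by (auto simp: eig_def)
  have "poly_act M r (M *v v - z *s v) = 0"
    using \<open>M *v w = z *s w\<close> by (simp add: poly_act_shift w_def)
  then have "D *v (M *v v - z *s v) = 0"
    using minimal by blast
  then have "N *v (D *v v) = z *s (D *v v)"
    by (simp add: matrix_vector_mult_diff_distrib matrix_vector_mul_assoc intertwine
        vector_scalar_commute)
  then have "z \<in> eig N"
    using v(1) by (auto simp: eig_def)
  with \<open>z \<in> eig M\<close> disjoint show False by blast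
qed

section \<open>Block vectors and block matrices\<close>

definition join :: "'a^'p \<Rightarrow> 'a^'q \<Rightarrow> 'a^('p + 'q)" where
  "join v w = (\<chi> i. case i of Inl a \<Rightarrow> v $ a | Inr b \<Rightarrow> w $ b)"

lemma sum_UNIV_Plus: "(\<Sum>i\<in>UNIV. f i) = (\<Sum>a\<in>UNIV. f (Inl a)) + (\<Sum>b\<in>UNIV. f (Inr b))"
  for f :: "'p::finite + 'q::finite \<Rightarrow> 'a::comm_monoid_add"
  unfolding UNIV_Plus_UNIV[symmetric] by (subst sum.Plus) simp_all

lemma join_exhaust: obtains v w where "x = join v w"
proof -
  have "x = join (\<chi> a. x $ Inl a) (\<chi> b. x $ Inr b)"
    by (auto simp: join_def vec_eq_iff split: sum.split)
  then show ?thesis by (rule that)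
qed

lemma join_eq_iff: "join v w = join v' w' \<longleftrightarrow> v = v' \<and> w = w'"
proof
  assume "join v w = join v' w'"
  then have "join v w $ i = join v' w' $ i" for i by simp
  from this[of "Inl _"] this[of "Inr _"] show "v = v' \<and> w = w'"
    by (simp add: join_def vec_eq_iff)
qed simp

lemma join_zero: "join 0 0 = 0"
  by (simp add: join_def vec_eq_iff split: sum.split)

lemma norm_join: "(norm (join v w))\<^sup>2 = (norm v)\<^sup>2 + (norm w)\<^sup>2"
  for v :: "complex^'p" and w :: "complex^'q"
  by (simp add: power2_norm_eq_inner inner_vec_def sum_UNIV_Plus join_def)

lemma inner_join: "join v w \<bullet> join v' w' = v \<bullet> v' + w \<bullet> w'"
  for v :: "complex^'p" and w :: "complex^'q"
  by (simp add: inner_vec_def sum_UNIV_Plus join_def)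

lemma join_diff: "join v w - join v' w' = join (v - v') (w - w')"
  by (simp add: join_def vec_eq_iff split: sum.split)

lemma block_mat_mult_join: "block_mat A B C D *v join v w = join (A *v v + B *v w) (C *v v + D *v w)"
  by (auto simp: block_mat_def join_def matrix_vector_mult_def vec_eq_iff sum_UNIV_Plus
      split: sum.split)

lemma block_col_mult: "block_col A C *v v = join (A *v v) (C *v v)"
  by (auto simp: block_col_def join_def matrix_vector_mult_def vec_eq_iff split: sum.split)

lemma block_mat_mult:
  "block_mat A B C D ** block_mat A' B' C' D'
   = block_mat (A ** A' + B ** C') (A ** B' + B ** D') (C ** A' + D ** C') (C ** B' + D ** D')"
  for A :: "complex^'p^'q"
proof -
  have "(block_mat A B C D ** block_mat A' B' C' D') *v x
     = block_mat (A ** A' + B ** C') (A ** B' + B ** D') (C ** A' + D ** C') (C ** B' + D ** D') *v x"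
    for x
    by (rule join_exhaust[of x])
       (simp add: matrix_vector_mul_assoc[symmetric] block_mat_mult_join algebra_simps)
  then show ?thesis by (simp add: matrix_eq)
qed

lemma block_mat_mult_block_col:
  "block_mat A B C D ** block_col X Y = block_col (A ** X + B ** Y) (C ** X + D ** Y)"
  for A :: "complex^'p^'q"
  by (simp add: matrix_eq matrix_vector_mul_assoc[symmetric] block_mat_mult_join block_col_mult
      algebra_simps)

lemma block_col_mult_matrix: "block_col X Y ** Z = block_col (X ** Z) (Y ** Z)"
  for X :: "complex^'p^'q"
  by (simp add: matrix_eq matrix_vector_mul_assoc[symmetric] block_col_mult)

lemma block_mat_eq_iff:
  "block_mat A B C D = block_mat A' B' C' D' \<longleftrightarrow> A = A' \<and> B = B' \<and> C = C' \<and> D = D'"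
  for A :: "complex^'p^'q"
proof
  assume eq: "block_mat A B C D = block_mat A' B' C' D'"
  have "block_mat A B C D *v join v w = block_mat A' B' C' D' *v join v w" for v w
    by (simp add: eq)
  from this[of _ 0] this[of 0] show "A = A' \<and> B = B' \<and> C = C' \<and> D = D'"
    by (simp add: block_mat_mult_join join_eq_iff matrix_eq)
qed simp

lemma block_mat_identity: "block_mat (mat 1) 0 0 (mat 1) = (mat 1 :: complex^('p::finite + 'q::finite)^('p + 'q))"
proof -
  have "block_mat (mat 1) 0 0 (mat 1) *v x = x" for x :: "complex^('p + 'q)"
    by (rule join_exhaust[of x]) (simp add: block_mat_mult_join)
  then show ?thesis by (simp add: matrix_eq)
qed

lemma block_mat_add:
  "block_mat A B C D + block_mat A' B' C' D' = block_mat (A + A') (B + B') (C + C') (D + D')"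
  by (auto simp: block_mat_def vec_eq_iff split: sum.split)

lemma ctranspose_block_mat:
  "ctranspose (block_mat A B C D)
   = block_mat (ctranspose A) (ctranspose C) (ctranspose B) (ctranspose D)"
  by (auto simp: block_mat_def ctranspose_def vec_eq_iff split: sum.split)

lemma norm_block_mat_mult_le:
  assumes "spectral_norm (block_mat A B C D) \<le> \<phi>"
  shows "(norm (A *v v + B *v w))\<^sup>2 + (norm (C *v v + D *v w))\<^sup>2 \<le> \<phi>\<^sup>2 * ((norm v)\<^sup>2 + (norm w)\<^sup>2)"
proof -
  have "norm (block_mat A B C D *v join v w) \<le> \<phi> * norm (join v w)"
    using assms by (simp add: spectral_norm_le_iff)
  then have "(norm (block_mat A B C D *v join v w))\<^sup>2 \<le> \<phi>\<^sup>2 * (norm (join v w))\<^sup>2"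
    by (metis norm_ge_zero power_mono power_mult_distrib)
  then show ?thesis
    by (simp add: block_mat_mult_join norm_join)
qed

section \<open>The Riccati equation of an invariant graph\<close>

text \<open>Equivalently, the graph of \<open>X\<close> is invariant under the block matrix with the blocks \<open>K11, \<dots>, K22\<close>:
  this matrix maps \<open>(v, X v)\<close> to \<open>(w, X w)\<close> with \<open>w = (K11 + K12 X) v\<close>.\<close>

definition riccati ::
  "complex^'m^'m \<Rightarrow> complex^'k^'m \<Rightarrow> complex^'m^'k \<Rightarrow> complex^'k^'k \<Rightarrow> complex^'m^'k \<Rightarrow> bool" where
  "riccati K11 K12 K21 K22 X \<longleftrightarrow> K21 + K22 ** X = X ** (K11 + K12 ** X)"

text \<open>The ball is an intersection of the closed convex sets \<open>{X. \<parallel>X x\<parallel> \<le> r \<parallel>x\<parallel>}\<close>, and it bounds every entry.\<close>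

lemma spectral_norm_ball:
  "compact {X :: complex^'q^'p. spectral_norm X \<le> r}"
  "convex {X :: complex^'q^'p. spectral_norm X \<le> r}"
proof -
  have ball: "{X :: complex^'q^'p. spectral_norm X \<le> r} = {X. \<forall>x. norm (X *v x) \<le> r * norm x}"
    by (simp add: spectral_norm_le_iff)
  have "bounded_linear (\<lambda>X :: complex^'q^'p. X *v x)" for x
    by (intro linear_conv_bounded_linear[THEN iffD1] linearI)
       (simp_all add: matrix_vector_mult_add_rdistrib scaleR_matrix_vector_mult)
  then have "continuous_on UNIV (\<lambda>X :: complex^'q^'p. X *v x)" for x
    by (rule linear_continuous_on)
  then have "closed {X :: complex^'q^'p. spectral_norm X \<le> r}"
    unfolding ball by (intro closed_Collect_all closed_Collect_le continuous_intros)
  moreover have "bounded {X :: complex^'q^'p. spectral_norm X \<le> r}"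
  proof (rule boundedI)
    fix X :: "complex^'q^'p" assume X: "X \<in> {X. spectral_norm X \<le> r}"
    have entry: "norm (X $ i $ j) \<le> r" for i j
    proof -
      have "X *v axis j 1 = column j X"
        by (simp add: matrix_vector_mult_def column_def axis_def vec_eq_iff if_distrib cong: if_cong)
      then have "norm (X $ i $ j) \<le> norm (X *v axis j 1)"
        using Finite_Cartesian_Product.norm_nth_le[of "column j X" i] by (simp add: column_def)
      also have "\<dots> \<le> r * norm (axis j (1 :: complex) :: complex^'q)"
        using X unfolding mem_Collect_eq spectral_norm_le_iff by blast
      finally show ?thesis by (simp add: norm_axis)
    qed
    have "norm X \<le> (\<Sum>i\<in>UNIV. norm (X $ i))"
      by (simp add: norm_vec_def[of X] L2_set_le_sum)
    also have "\<dots> \<le> (\<Sum>i\<in>UNIV. \<Sum>j\<in>UNIV. norm (X $ i $ j))"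
      by (intro sum_mono) (simp add: norm_vec_def[of "X $ _"] L2_set_le_sum)
    also have "\<dots> \<le> (\<Sum>i\<in>(UNIV :: 'p set). \<Sum>j\<in>(UNIV :: 'q set). r)"
      by (intro sum_mono entry)
    finally show "norm X \<le> (\<Sum>i\<in>(UNIV :: 'p set). \<Sum>j\<in>(UNIV :: 'q set). r)" .
  qed
  ultimately show "compact {X :: complex^'q^'p. spectral_norm X \<le> r}"
    by (simp add: compact_eq_bounded_closed)
  show "convex {X :: complex^'q^'p. spectral_norm X \<le> r}"
    unfolding ball
  proof (rule convexI, clarsimp)
    fix X Y :: "complex^'q^'p" and u v :: real and x
    assume *: "\<forall>x. norm (X *v x) \<le> r * norm x" "\<forall>x. norm (Y *v x) \<le> r * norm x"
      and uv: "0 \<le> u" "0 \<le> v" "u + v = 1"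
    have "norm ((u *\<^sub>R X + v *\<^sub>R Y) *v x) \<le> u * norm (X *v x) + v * norm (Y *v x)"
      using norm_triangle_ineq[of "u *\<^sub>R (X *v x)" "v *\<^sub>R (Y *v x)"] uv
      by (simp add: matrix_vector_mult_add_rdistrib scaleR_matrix_vector_mult)
    also have "\<dots> \<le> u * (r * norm x) + v * (r * norm x)"
      using * uv by (intro add_mono mult_left_mono) auto
    also have "\<dots> = r * norm x"
      using uv by (simp flip: distrib_right)
    finally show "norm ((u *\<^sub>R X + v *\<^sub>R Y) *v x) \<le> r * norm x" .
  qed
qed

text \<open>The matrix is \<open>[X, -I] F [I; X]\<close>, and both outer factors have norm at most \<open>sqrt (1 + \<parallel>X\<parallel>\<^sup>2)\<close>. Treating
  the blocks of \<open>F\<close> together, instead of bounding each by \<open>\<phi>\<close> separately, is what makes the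
  condition \<open>2 * \<phi> \<le> s\<close> sufficient later on.\<close>

lemma riccati_residual_norm_le:
  fixes X :: "complex^'m^'k"
  assumes F: "spectral_norm (block_mat F11 F12 F21 F22) \<le> \<phi>"
  shows "spectral_norm (X ** (F11 + F12 ** X) - (F21 + F22 ** X))
    \<le> \<phi> * (1 + (spectral_norm X)\<^sup>2)"
proof (rule spectral_norm_le)
  fix v
  have "0 \<le> \<phi>"
    using F spectral_norm_nonneg order_trans by blast
  define x where "x = spectral_norm X"
  define c where "c = F11 *v v + F12 *v (X *v v)"
  define d where "d = F21 *v v + F22 *v (X *v v)"
  have "norm (X *v v) \<le> x * norm v"
    by (simp add: x_def norm_mult_le_spectral_norm)
  then have "(norm (X *v v))\<^sup>2 \<le> x\<^sup>2 * (norm v)\<^sup>2"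
    by (metis norm_ge_zero power_mono power_mult_distrib)
  then have "\<phi>\<^sup>2 * ((norm v)\<^sup>2 + (norm (X *v v))\<^sup>2) \<le> \<phi>\<^sup>2 * ((1 + x\<^sup>2) * (norm v)\<^sup>2)"
    by (intro mult_left_mono) (simp_all add: algebra_simps)
  with norm_block_mat_mult_le[OF F, of v "X *v v"]
  have cd: "(norm c)\<^sup>2 + (norm d)\<^sup>2 \<le> \<phi>\<^sup>2 * ((1 + x\<^sup>2) * (norm v)\<^sup>2)"
    by (simp add: c_def d_def)
  have "(X ** (F11 + F12 ** X) - (F21 + F22 ** X)) *v v = X *v c - d"
    by (simp add: c_def d_def matrix_vector_mul_assoc[symmetric] algebra_simps)
  also have "norm \<dots> \<le> x * norm c + norm d"
    using norm_triangle_ineq4[of "X *v c" d] norm_mult_le_spectral_norm[of X c] by (simp add: x_def)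
  finally have "(norm ((X ** (F11 + F12 ** X) - (F21 + F22 ** X)) *v v))\<^sup>2 \<le> (x * norm c + norm d)\<^sup>2"
    by (intro power_mono) auto
  \<comment> \<open>Cauchy-Schwarz in the plane for \<open>(x, 1)\<close> and \<open>(\<parallel>c\<parallel>, \<parallel>d\<parallel>)\<close>\<close>
  also have "\<dots> \<le> (1 + x\<^sup>2) * ((norm c)\<^sup>2 + (norm d)\<^sup>2)"
    using zero_le_power2[of "x * norm d - norm c"] by (simp add: power2_eq_square algebra_simps)
  also have "\<dots> \<le> (1 + x\<^sup>2) * (\<phi>\<^sup>2 * ((1 + x\<^sup>2) * (norm v)\<^sup>2))"
    by (intro mult_left_mono cd) auto
  also have "\<dots> = (\<phi> * (1 + x\<^sup>2) * norm v)\<^sup>2"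
    by (simp add: power2_eq_square)
  finally show "norm ((X ** (F11 + F12 ** X) - (F21 + F22 ** X)) *v v)
      \<le> \<phi> * (1 + (spectral_norm X)\<^sup>2) * norm v"
    using \<open>0 \<le> \<phi>\<close> by (simp add: power2_le_iff_abs_le x_def)
qed

text \<open>The Riccati equation is \<open>T X = G X\<close> with \<open>T X = C X - X B\<close> and \<open>G X = [X, -I] F [I; X]\<close>. Positive
  separation makes \<open>T\<close> invertible with \<open>\<parallel>T\<^sup>-\<^sup>1\<parallel> \<le> 1 / s\<close>. The map \<open>T\<^sup>-\<^sup>1 \<circ> G\<close> sends the ball of radius
  \<open>r = 2 * \<phi> / s\<close> to itself, since \<open>\<phi> * (1 + r\<^sup>2) / s \<le> 2 * \<phi> / s = r\<close> by \<open>r \<le> 1\<close>. It need not be a contraction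
  there, so Brouwer's theorem provides the fixed point.\<close>

lemma riccati_solution_exists:
  fixes B F11 :: "complex^'m^'m" and C F22 :: "complex^'k^'k"
  assumes s: "s = sep C B" "0 < s"
    and F: "spectral_norm (block_mat F11 F12 F21 F22) \<le> \<phi>" and small: "2 * \<phi> \<le> s"
  obtains X where "riccati (B + F11) F12 F21 (C + F22) X" "spectral_norm X \<le> 2 * \<phi> / s"
proof -
  have "0 \<le> \<phi>"
    using F spectral_norm_nonneg order_trans by blast
  define r where "r = 2 * \<phi> / s"
  define T where "T = (\<lambda>X :: complex^'m^'k. C ** X - X ** B)"
  define G where "G = (\<lambda>X :: complex^'m^'k. X ** (F11 + F12 ** X) - (F21 + F22 ** X))"
  have "linear T"
    by (intro linearI) (simp_all add: T_def matrix_add_ldistrib matrix_add_rdistrib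
        matrix_mult_scaleR_left matrix_mult_scaleR_right scaleR_diff_right)
  have T_le: "s * spectral_norm X \<le> spectral_norm (T X)" for X
    using sep_mult_le by (simp add: s T_def)
  have "inj T"
  proof (rule linear_injective_0[OF \<open>linear T\<close>, THEN iffD2], intro allI impI)
    fix X assume "T X = 0"
    then have "s * spectral_norm X \<le> 0"
      using T_le[of X] by (simp add: spectral_norm_eq_0[THEN iffD2])
    then have "spectral_norm X = 0"
      using s(2) spectral_norm_nonneg[of X] by (simp add: mult_le_0_iff)
    then show "X = 0" by (simp add: spectral_norm_eq_0)
  qed
  then obtain H where H: "linear H" "\<And>X. T (H X) = X"
    using linear_injective_isomorphism[OF \<open>linear T\<close>] by blast
  have "\<exists>X\<in>{X. spectral_norm X \<le> r}. H (G X) = X"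
  proof (rule brouwer[of "{X. spectral_norm X \<le> r}" "H \<circ> G", unfolded o_def])
    have "0 \<in> {X :: complex^'m^'k. spectral_norm X \<le> r}"
      using \<open>0 \<le> \<phi>\<close> s(2) by (simp add: r_def spectral_norm_eq_0[THEN iffD2])
    then show "{X :: complex^'m^'k. spectral_norm X \<le> r} \<noteq> {}" by blast
    have "continuous_on S G" for S
      unfolding G_def matrix_matrix_mult_def plus_vec_def minus_vec_def
      by (intro continuous_intros)
    moreover have "continuous_on S H" for S
      using H(1) by (simp add: linear_continuous_on linear_conv_bounded_linear)
    ultimately show "continuous_on {X. spectral_norm X \<le> r} (\<lambda>X. H (G X))"
      by (metis continuous_on_compose2 subset_UNIV)
    show "(\<lambda>X. H (G X)) \<in> {X. spectral_norm X \<le> r} \<rightarrow> {X. spectral_norm X \<le> r}"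
    proof clarsimp
      fix X :: "complex^'m^'k" assume X: "spectral_norm X \<le> r"
      have "s * spectral_norm (H (G X)) \<le> \<phi> * (1 + (spectral_norm X)\<^sup>2)"
        using T_le[of "H (G X)"] riccati_residual_norm_le[OF F, of X] by (simp add: H G_def)
      also have "\<dots> \<le> \<phi> * (1 + 1)"
        using X \<open>0 \<le> \<phi>\<close> s(2) small order_trans[OF X, of 1]
        by (intro mult_left_mono add_left_mono) (simp_all add: r_def power_le_one)
      finally show "spectral_norm (H (G X)) \<le> r"
        using s(2) by (simp add: r_def field_simps)
    qed
  qed (use spectral_norm_ball in blast)+
  then obtain X where X: "spectral_norm X \<le> r" "H (G X) = X"
    by auto
  then have "T X = G X"
    using H(2)[of "G X"] by simp
  then have "riccati (B + F11) F12 F21 (C + F22) X"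
    unfolding riccati_def T_def G_def
    by (simp add: matrix_add_ldistrib matrix_add_rdistrib algebra_simps)
  with X(1) show ?thesis
    by (intro that) (simp_all add: r_def)
qed

lemma riccati_eigenvector_block:
  assumes "riccati K11 K12 K21 K22 X" "(K11 + K12 ** X) *v v = z *s v"
  shows "K21 *v v + K22 *v (X *v v) = z *s (X *v v)"
proof -
  have "K21 *v v + K22 *v (X *v v) = (K21 + K22 ** X) *v v"
    by (simp add: matrix_vector_mult_add_rdistrib matrix_vector_mul_assoc)
  also have "\<dots> = X *v ((K11 + K12 ** X) *v v)"
    using assms(1) by (simp add: riccati_def matrix_vector_mul_assoc)
  finally show ?thesis
    by (simp add: assms(2) vector_scalar_commute)
qed

text \<open>An eigenvector \<open>v\<close> of \<open>B + F11 + F12 X\<close> gives the eigenvector \<open>(v, X v)\<close> of the perturbed block diagonal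
  matrix. Its second component is not larger than the first, so
  \<open>dominant_block_in_pseudospectrum\<close> applies. The direct estimate of \<open>\<parallel>F11 + F12 X\<parallel>\<close> would only give
  the radius \<open>\<phi> * sqrt (1 + \<parallel>X\<parallel>\<^sup>2)\<close>.\<close>

lemma eig_subset_pseudospectrum:
  assumes X: "riccati (B + F11) F12 F21 (C + F22) X" "spectral_norm X \<le> 1"
    and F: "spectral_norm (block_mat F11 F12 F21 F22) \<le> \<phi>"
    and sep: "2 * \<phi> < sep C B"
  shows "eig (B + F11 + F12 ** X) \<subseteq> pseudospectrum \<phi> B"
proof
  fix z assume "z \<in> eig (B + F11 + F12 ** X)"
  then obtain v where v: "v \<noteq> 0" "(B + F11 + F12 ** X) *v v = z *s v"
    by (auto simp: eig_def)
  let ?w = "X *v v"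
  have "B *v v - z *s v = - (F11 *v v + F12 *v ?w)"
    using v(2) by (simp add: matrix_vector_mult_add_rdistrib matrix_vector_mul_assoc algebra_simps)
  moreover have "C *v ?w - z *s ?w = - (F21 *v v + F22 *v ?w)"
    using riccati_eigenvector_block[OF X(1) v(2)]
    by (simp add: matrix_vector_mult_add_rdistrib algebra_simps)
  ultimately have "(norm (B *v v - z *s v))\<^sup>2 + (norm (C *v ?w - z *s ?w))\<^sup>2
      \<le> \<phi>\<^sup>2 * ((norm v)\<^sup>2 + (norm ?w)\<^sup>2)"
    using norm_block_mat_mult_le[OF F, of v ?w] by (simp only: norm_minus_cancel)
  moreover have "norm ?w \<le> norm v"
    using norm_mult_le_spectral_norm[of X v] X(2) mult_right_mono[OF X(2) norm_ge_zero[of v]]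
    by simp
  moreover have "0 \<le> \<phi>"
    using F spectral_norm_nonneg order_trans by blast
  ultimately show "z \<in> pseudospectrum \<phi> B"
    using dominant_block_in_pseudospectrum[OF sep _ v(1)] by blast
qed

text \<open>The orthogonal complement of the graph of \<open>X\<close> consists of the vectors \<open>(- X\<^sup>* u, u)\<close>, and it is invariant
  under the adjoint. With the two blocks interchanged it is the graph of \<open>- X\<^sup>*\<close>.\<close>

lemma riccati_adjoint:
  assumes "riccati K11 K12 K21 K22 X"
  shows "riccati (ctranspose K22) (ctranspose K12) (ctranspose K21) (ctranspose K11) (- ctranspose X)"
proof -
  have "ctranspose (K21 + K22 ** X) = ctranspose (X ** (K11 + K12 ** X))"
    using assms by (simp add: riccati_def)
  then show ?thesis
    by (simp add: riccati_def ctranspose_add ctranspose_mult matrix_mult_uminus_left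
        matrix_mult_uminus_right matrix_mult_diff_right matrix_add_ldistrib matrix_add_rdistrib matrix_mul_assoc
        algebra_simps)
qed

lemma spectral_norm_block_swap:
  fixes A :: "complex^'p^'r" and D :: "complex^'q^'t"
  assumes "spectral_norm (block_mat A B C D) \<le> \<phi>"
  shows "spectral_norm (block_mat D C B A) \<le> \<phi>"
proof (rule spectral_norm_le)
  fix x :: "complex^('q + 'p)"
  have "0 \<le> \<phi>"
    using assms spectral_norm_nonneg order_trans by blast
  obtain v w where x: "x = join v w" by (rule join_exhaust)
  have "(norm (block_mat D C B A *v x))\<^sup>2 \<le> (\<phi> * norm x)\<^sup>2"
    using norm_block_mat_mult_le[OF assms, of w v]
    by (simp add: x block_mat_mult_join norm_join power_mult_distrib add.commute)
  then show "norm (block_mat D C B A *v x) \<le> \<phi> * norm x"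
    using \<open>0 \<le> \<phi>\<close> by (simp add: power2_le_iff_abs_le)
qed

text \<open>This is \<open>eig_subset_pseudospectrum\<close> for the adjoint problem of \<open>riccati_adjoint\<close>, whose compression
  to the graph of \<open>- X\<^sup>*\<close> is \<open>(C + F22 - X F12)\<^sup>*\<close>.\<close>

lemma eig_subset_pseudospectrum_complementary:
  assumes X: "riccati (B + F11) F12 F21 (C + F22) X" "spectral_norm X \<le> 1"
    and F: "spectral_norm (block_mat F11 F12 F21 F22) \<le> \<phi>"
    and sep: "2 * \<phi> < sep C B"
  shows "eig (C + F22 - X ** F12) \<subseteq> pseudospectrum \<phi> C"
proof
  fix z assume "z \<in> eig (C + F22 - X ** F12)"
  then have "cnj z \<in> eig (ctranspose (C + F22 - X ** F12))"
    by (rule eig_ctranspose)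
  also have "ctranspose (C + F22 - X ** F12)
      = ctranspose C + ctranspose F22 + ctranspose F12 ** (- ctranspose X)"
    by (simp add: ctranspose_add ctranspose_diff ctranspose_mult matrix_mult_uminus_right)
  also have "eig \<dots> \<subseteq> pseudospectrum \<phi> (ctranspose C)"
  proof (rule eig_subset_pseudospectrum)
    show "riccati (ctranspose C + ctranspose F22) (ctranspose F12) (ctranspose F21)
        (ctranspose B + ctranspose F11) (- ctranspose X)"
      using riccati_adjoint[OF X(1)] by (simp add: ctranspose_add)
    show "spectral_norm (- ctranspose X) \<le> 1"
      using X(2) spectral_norm_scaleR[of "- 1" "ctranspose X"] by simp
    show "spectral_norm (block_mat (ctranspose F22) (ctranspose F12) (ctranspose F21) (ctranspose F11)) \<le> \<phi>"
    proof (rule spectral_norm_block_swap)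
      show "spectral_norm (block_mat (ctranspose F11) (ctranspose F21) (ctranspose F12) (ctranspose F22)) \<le> \<phi>"
        using F by (simp flip: ctranspose_block_mat)
    qed
    show "2 * \<phi> < sep (ctranspose B) (ctranspose C)"
      using sep sep_ctranspose_le[of C B] by linarith
  qed
  finally show "z \<in> pseudospectrum \<phi> C"
    using pseudospectrum_ctranspose[of "cnj z" \<phi> "ctranspose C"] by simp
qed

text \<open>Subtracting the two equations shows that \<open>X - Y\<close> intertwines the compression that belongs to \<open>X\<close> with
  the complementary one that belongs to \<open>Y\<close>. Their spectra lie in disjoint pseudospectra.\<close>

lemma riccati_solution_unique:
  assumes X: "riccati (B + F11) F12 F21 (C + F22) X" "spectral_norm X \<le> 1"
    and Y: "riccati (B + F11) F12 F21 (C + F22) Y" "spectral_norm Y \<le> 1"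
    and F: "spectral_norm (block_mat F11 F12 F21 F22) \<le> \<phi>"
    and sep: "2 * \<phi> < sep C B"
  shows "X = Y"
proof -
  have "(C + F22 - Y ** F12) ** (X - Y) = (X - Y) ** (B + F11 + F12 ** X)"
  proof -
    have "C ** X = X ** (B + F11) + X ** F12 ** X - F21 - F22 ** X"
      "C ** Y = Y ** (B + F11) + Y ** F12 ** Y - F21 - F22 ** Y"
      using X(1) Y(1) unfolding riccati_def
      by (simp_all add: matrix_add_ldistrib matrix_add_rdistrib matrix_mul_assoc algebra_simps)
    then show ?thesis
      by (simp add: matrix_add_ldistrib matrix_add_rdistrib matrix_mult_diff_left
          matrix_mult_diff_right matrix_mul_assoc)
  qed
  moreover have "eig (B + F11 + F12 ** X) \<inter> eig (C + F22 - Y ** F12) = {}"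
    using eig_subset_pseudospectrum[OF X F] eig_subset_pseudospectrum_complementary[OF Y F]
      pseudospectra_disjoint[of \<phi> C B] sep by blast
  ultimately have "X - Y = 0"
    by (rule sylvester_homogeneous_unique)
  then show ?thesis by simp
qed

section \<open>Column spaces and orthonormal bases\<close>

lemma column_space_eq_range: "column_space B = range ((*v) B)"
proof
  show "range ((*v) B) \<subseteq> column_space B"
    by (auto simp: column_space_def matrix_vector_mult_in_columnspace_gen)
  have "vec.subspace (range ((*v) B))"
    by (metis matrix_vector_mul_linear_gen vec.subspace_UNIV vec.subspace_image)
  moreover have "column j B = B *v axis j 1" for j
    by (simp add: matrix_vector_mult_def column_def axis_def vec_eq_iff if_distrib cong: if_cong)
  ultimately show "column_space B \<subseteq> range ((*v) B)"
    unfolding column_space_def by (intro vec.span_minimal) (auto simp: columns_def)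
qed

definition full_column_rank :: "complex^'k^'n \<Rightarrow> bool" where
  "full_column_rank B \<longleftrightarrow> (\<forall>x. B *v x = 0 \<longrightarrow> x = 0)"

lemma full_column_rank_inj: "full_column_rank B \<longleftrightarrow> inj ((*v) B)"
  by (simp add: full_column_rank_def vec.inj_iff_eq_0)

lemma rank_full_column_rank:
  fixes B :: "complex^'k^'n"
  assumes "full_column_rank B"
  shows "rank B = CARD('k)"
proof -
  have "vec.span (rows B) = UNIV"
    using assms matrix_left_invertible_ker[of B] matrix_left_invertible_span_rows_gen[of B]
    by (simp add: full_column_rank_def)
  then have "vec.dim (rows B) = vec.dim (UNIV :: (complex^'k) set)"
    by (metis vec.dim_span)
  then show ?thesis
    by (simp add: row_rank_def_gen card_cart_basis)
qed

lemma column_space_subspace: "vec.subspace (column_space B)"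
  by (simp add: column_space_def)

lemma dim_column_space:
  fixes B :: "complex^'k^'n"
  assumes "full_column_rank B"
  shows "vec.dim (column_space B) = CARD('k)"
proof -
  have "inj_on ((*v) B) (vec.span UNIV)"
    using assms by (simp add: full_column_rank_inj)
  then have "vec.dim (range ((*v) B)) = vec.dim (UNIV :: (complex^'k) set)"
    by (intro vec.dim_image_eq) simp_all
  then show ?thesis
    by (simp add: column_space_eq_range card_cart_basis)
qed

text \<open>Induction on the index set: as long as \<open>F\<close> does not exhaust all \<open>vec.dim W\<close> indices, some \<open>w \<in> W\<close> lies
  outside the span of the vectors found so far. Subtract its projection and normalize.\<close>

lemma gram_schmidt:
  fixes W :: "(complex^'n) set" and F :: "'k::finite set"
  assumes "vec.subspace W" "vec.dim W = CARD('k)"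
  shows "\<exists>f. (\<forall>i\<in>F. f i \<in> W) \<and> (\<forall>i\<in>F. \<forall>j\<in>F. cinner (f i) (f j) = (if i = j then 1 else 0))"
  using finite[of F]
proof (induction F rule: finite_induct)
  case (insert a F)
  then obtain f where f: "\<forall>i\<in>F. f i \<in> W"
    "\<And>i j. i \<in> F \<Longrightarrow> j \<in> F \<Longrightarrow> cinner (f i) (f j) = (if i = j then 1 else 0)"
    by blast
  have "\<not> W \<subseteq> vec.span (f ` F)"
  proof
    assume "W \<subseteq> vec.span (f ` F)"
    then have "CARD('k) \<le> card (f ` F)"
      using vec.dim_le_card[of W "f ` F"] assms(2) by simp
    also have "\<dots> \<le> card F"
      by (simp add: card_image_le)
    also have "card F < card (insert a F)"
      using insert.hyps by simp
    also have "\<dots> \<le> CARD('k)"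
      by (intro card_mono) auto
    finally show False by simp
  qed
  then obtain w where w: "w \<in> W" "w \<notin> vec.span (f ` F)" by blast
  define q where "q = (\<Sum>i\<in>F. cinner (f i) w *s f i)"
  define u where "u = w - q"
  have "q \<in> vec.span (f ` F)"
    unfolding q_def by (intro vec.span_sum vec.span_scale vec.span_base) auto
  then have "u \<noteq> 0"
    using w(2) by (auto simp: u_def)
  have "q \<in> W"
    unfolding q_def using f(1) assms(1) by (intro vec.subspace_sum vec.subspace_scale) auto
  then have "u \<in> W"
    unfolding u_def using w(1) assms(1) by (intro vec.subspace_diff)
  define e where "e = complex_of_real (1 / norm u) *s u"
  have "e \<in> W"
    unfolding e_def using \<open>u \<in> W\<close> assms(1) by (intro vec.subspace_scale)
  have "cinner e e = 1"
  proof -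
    have "norm e = 1"
      using \<open>u \<noteq> 0\<close> by (simp add: e_def norm_smult norm_divide)
    then show ?thesis by (simp add: cinner_self)
  qed
  have left: "cinner (f j) e = 0" if "j \<in> F" for j
  proof -
    have "cinner (f j) q = (\<Sum>i\<in>F. if i = j then cinner (f j) w else 0)"
      unfolding q_def cinner_sum_right cinner_smult_right using that by (intro sum.cong) (auto simp: f(2))
    then have "cinner (f j) u = 0"
      using that by (simp add: u_def cinner_diff_right)
    then show ?thesis by (simp add: e_def cinner_smult_right)
  qed
  then have "cinner e (f j) = 0" if "j \<in> F" for j
    using that cinner_cnj[of "f j" e] by simp
  with left f \<open>e \<in> W\<close> \<open>cinner e e = 1\<close> insert.hyps(2) show ?case
    by (intro exI[of _ "f(a := e)"]) auto
qed simp

lemma orthonormal_basis_exists: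
  fixes Z :: "complex^'k^'n"
  assumes "full_column_rank Z"
  obtains U :: "complex^'k^'n" where "ctranspose U ** U = mat 1" "column_space U = column_space Z"
proof -
  obtain f :: "'k \<Rightarrow> complex^'n" where f: "\<And>i. f i \<in> column_space Z"
    "\<And>i j. cinner (f i) (f j) = (if i = j then 1 else 0)"
    using gram_schmidt[where F = UNIV, OF column_space_subspace dim_column_space[OF assms]] by auto
  define U :: "complex^'k^'n" where "U = (\<chi> i j. f j $ i)"
  have "ctranspose U ** U = mat 1"
    using f(2) by (simp add: U_def ctranspose_def matrix_matrix_mult_def mat_def vec_eq_iff cinner_def)
  then have "full_column_rank U"
    unfolding full_column_rank_def using matrix_left_invertible_ker by blast
  have "column j U = f j" for j
    by (simp add: column_def U_def)
  then have "column_space U \<subseteq> column_space Z"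
    unfolding column_space_def[of U]
    by (intro vec.span_minimal column_space_subspace) (auto simp: columns_def f(1))
  then have "column_space U = column_space Z"
    using dim_column_space[OF assms] dim_column_space[OF \<open>full_column_rank U\<close>]
    by (intro vec.subspace_dim_equal column_space_subspace) simp_all
  with \<open>ctranspose U ** U = mat 1\<close> show ?thesis by (rule that)
qed

lemma norm_orthonormal_mult:
  assumes "ctranspose U ** U = mat 1"
  shows "norm (U *v x) = norm x"
proof -
  have "(norm (U *v x))\<^sup>2 = (norm x)\<^sup>2"
    using inner_ctranspose[of U "U *v x" x] assms
    by (simp add: power2_norm_eq_inner matrix_vector_mul_assoc)
  then show ?thesis by simp
qed

section \<open>The smallest singular value\<close>

text \<open>Eigenvectors of the self-adjoint matrix \<open>B\<^sup>* B\<close> for distinct eigenvalues are orthogonal, hence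
  independent, already for the real inner product.\<close>

lemma finite_singular_values: "finite (singular_values B)"
proof -
  define H where "H = ctranspose B ** B"
  have sym: "(H *v x) \<bullet> y = x \<bullet> (H *v y)" for x y
    using inner_ctranspose[of H x y] by (simp add: H_def ctranspose_mult)
  have "\<forall>\<sigma>\<in>singular_values B. \<exists>v. v \<noteq> 0 \<and> H *v v = (\<sigma>\<^sup>2) *\<^sub>R v"
    by (auto simp: singular_values_def eig_def H_def of_real_smult simp flip: of_real_power)
  then obtain f where f: "\<And>\<sigma>. \<sigma> \<in> singular_values B \<Longrightarrow> f \<sigma> \<noteq> 0 \<and> H *v f \<sigma> = (\<sigma>\<^sup>2) *\<^sub>R f \<sigma>"
    by metis
  have orth: "f \<sigma> \<bullet> f \<tau> = 0" if "\<sigma> \<in> singular_values B" "\<tau> \<in> singular_values B" "\<sigma> \<noteq> \<tau>" for \<sigma> \<tau>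
  proof -
    have "\<sigma>\<^sup>2 * (f \<sigma> \<bullet> f \<tau>) = \<tau>\<^sup>2 * (f \<sigma> \<bullet> f \<tau>)"
      using sym[of "f \<sigma>" "f \<tau>"] f[OF that(1)] f[OF that(2)] by simp
    moreover have "\<sigma>\<^sup>2 \<noteq> \<tau>\<^sup>2"
      using that by (auto simp: singular_values_def)
    ultimately show ?thesis by simp
  qed
  have "independent (f ` singular_values B)"
    using f orth by (intro pairwise_orthogonal_independent)
      (auto simp: pairwise_def orthogonal_def dest: orth)
  then have "finite (f ` singular_values B)"
    by (rule independent_imp_finite)
  moreover have "inj_on f (singular_values B)"
    using f orth by (metis inj_onI inner_eq_zero_iff)
  ultimately show ?thesis
    by (rule finite_imageD)
qed

lemma norm_add_scaleR_power2:
  "(norm (x + t *\<^sub>R y))\<^sup>2 = (norm x)\<^sup>2 + 2 * t * (x \<bullet> y) + t\<^sup>2 * (norm y)\<^sup>2"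
  for x y :: "'a::real_inner"
  unfolding power2_norm_eq_inner
  by (simp add: inner_add_left inner_add_right inner_commute power2_eq_square algebra_simps)

text \<open>Let \<open>v\<close> minimize \<open>\<parallel>B v\<parallel>\<close> on the unit sphere and let \<open>m\<close> be the minimum. The quadratic form
  \<open>x \<mapsto> \<parallel>B x\<parallel>\<^sup>2 - m\<^sup>2 \<parallel>x\<parallel>\<^sup>2\<close> is nonnegative and vanishes at \<open>v\<close>, so its derivative
  \<open>r = B\<^sup>* B v - m\<^sup>2 v\<close> there (up to a factor 2) is zero.\<close>

lemma smallest_singular_value_attained:
  fixes B :: "complex^'k^'k"
  obtains v where "norm v = 1" "norm (B *v v) \<in> singular_values B"
    "\<And>x. norm (B *v v) * norm x \<le> norm (B *v x)"
proof -
  have cont: "continuous_on (sphere 0 1) (\<lambda>v. norm (B *v v))"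
    by (intro continuous_intros linear_continuous_on) simp
  have "sphere (0 :: complex^'k) 1 \<noteq> {}"
    by simp
  from continuous_attains_inf[OF compact_sphere this cont]
  obtain v where "v \<in> sphere 0 1" "\<forall>x\<in>sphere 0 1. norm (B *v v) \<le> norm (B *v x)" ..
  then have v: "norm v = 1" "\<And>x. norm x = 1 \<Longrightarrow> norm (B *v v) \<le> norm (B *v x)"
    by auto
  define m where "m = norm (B *v v)"
  have min: "m * norm x \<le> norm (B *v x)" for x
  proof (cases "x = 0")
    case False
    then have "m \<le> norm (B *v ((1 / norm x) *\<^sub>R x))"
      unfolding m_def by (intro v(2)) simp
    then show ?thesis
      using False by (simp add: matrix_vector_mult_scaleR_complex field_simps)
  qed simp
  define r where "r = ctranspose B *v (B *v v) - (m\<^sup>2) *\<^sub>R v"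
  have nonneg: "0 \<le> 2 * t * (r \<bullet> r) + t\<^sup>2 * ((norm (B *v r))\<^sup>2 - m\<^sup>2 * (norm r)\<^sup>2)" for t
  proof -
    have "m\<^sup>2 * (norm (v + t *\<^sub>R r))\<^sup>2 \<le> (norm (B *v (v + t *\<^sub>R r)))\<^sup>2"
      using power_mono[OF min[of "v + t *\<^sub>R r"], of 2] by (simp add: power_mult_distrib m_def)
    moreover have "(norm (v + t *\<^sub>R r))\<^sup>2 = 1 + 2 * t * (v \<bullet> r) + t\<^sup>2 * (norm r)\<^sup>2"
      by (simp add: norm_add_scaleR_power2 v(1))
    moreover have "(norm (B *v (v + t *\<^sub>R r)))\<^sup>2
        = m\<^sup>2 + 2 * t * ((B *v v) \<bullet> (B *v r)) + t\<^sup>2 * (norm (B *v r))\<^sup>2"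
      by (simp add: norm_add_scaleR_power2 m_def matrix_vector_right_distrib
          matrix_vector_mult_scaleR_complex)
    moreover have "r \<bullet> r = (B *v v) \<bullet> (B *v r) - m\<^sup>2 * (v \<bullet> r)"
      by (subst r_def) (simp add: inner_diff_left inner_ctranspose)
    then have "(B *v v) \<bullet> (B *v r) = r \<bullet> r + m\<^sup>2 * (v \<bullet> r)"
      by simp
    ultimately show ?thesis
      by (simp add: distrib_left right_diff_distrib mult_ac)
  qed
  have "r = 0"
  proof (rule ccontr)
    assume "r \<noteq> 0"
    define g where "g = (norm (B *v r))\<^sup>2 - m\<^sup>2 * (norm r)\<^sup>2"
    \<comment> \<open>A step against the gradient, short enough for the linear term to dominate: \<open>\<bar>t g\<bar> \<le> r \<bullet> r\<close>\<close>
    define t where "t = - (r \<bullet> r) / (\<bar>g\<bar> + 1)"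
    have "r \<bullet> r > 0" using \<open>r \<noteq> 0\<close> by simp
    then have "t < 0" by (simp add: t_def divide_neg_pos)
    have "2 * t * (r \<bullet> r) + t\<^sup>2 * g = t * (2 * (r \<bullet> r) + t * g)"
      by (simp add: power2_eq_square algebra_simps)
    moreover have "2 * (r \<bullet> r) + t * g > 0"
    proof -
      have "- (t * g) \<le> \<bar>t\<bar> * \<bar>g\<bar>"
        by (metis abs_ge_minus_self abs_mult)
      also have "\<dots> \<le> r \<bullet> r"
        using \<open>r \<bullet> r > 0\<close> by (simp add: t_def field_simps)
      finally show ?thesis using \<open>r \<bullet> r > 0\<close> by linarith
    qed
    ultimately have "2 * t * (r \<bullet> r) + t\<^sup>2 * g < 0"
      using \<open>t < 0\<close> by (simp add: mult_neg_pos)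
    then show False using nonneg[of t] by (simp add: g_def)
  qed
  then have "ctranspose B ** B *v v = complex_of_real (m\<^sup>2) *s v"
    by (simp add: r_def of_real_smult matrix_vector_mul_assoc del: of_real_power)
  then have "m \<in> singular_values B"
    using v(1) by (auto simp: singular_values_def eig_def m_def intro!: exI[of _ v])
  then show ?thesis
    using v(1) min by (intro that[of v]) (simp_all add: m_def)
qed

lemma le_sigma_min_iff:
  fixes B :: "complex^'k^'k"
  shows "c \<le> sigma_min B \<longleftrightarrow> (\<forall>x. c * norm x \<le> norm (B *v x))"
proof -
  obtain v where v: "norm v = 1" "norm (B *v v) \<in> singular_values B"
    "\<And>x. norm (B *v v) * norm x \<le> norm (B *v x)"
    using smallest_singular_value_attained[of B] by metis
  have "norm (B *v v) \<le> \<sigma>" if \<sigma>: "\<sigma> \<in> singular_values B" for \<sigma>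
  proof -
    from \<sigma> obtain w where w: "w \<noteq> 0" "ctranspose B ** B *v w = complex_of_real (\<sigma>\<^sup>2) *s w" "0 \<le> \<sigma>"
      by (auto simp: singular_values_def eig_def)
    have "(norm (B *v w))\<^sup>2 = (\<sigma> * norm w)\<^sup>2"
      using inner_ctranspose[of B "B *v w" w] w(2)
      by (simp add: power2_norm_eq_inner matrix_vector_mul_assoc of_real_smult power_mult_distrib
          del: of_real_power)
    then have "norm (B *v w) = \<sigma> * norm w"
      using w(3) by simp
    with v(3)[of w] w(1) show ?thesis by simp
  qed
  then have eq: "sigma_min B = norm (B *v v)"
    unfolding sigma_min_def using v(2) finite_singular_values by (intro Min_eqI) auto
  show ?thesis
  proof
    assume "c \<le> sigma_min B"
    then show "\<forall>x. c * norm x \<le> norm (B *v x)"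
      using v(3) by (metis eq mult_right_mono norm_ge_zero order_trans)
  next
    assume "\<forall>x. c * norm x \<le> norm (B *v x)"
    then show "c \<le> sigma_min B"
      using eq v(1) by (metis mult.right_neutral)
  qed
qed

section \<open>The largest canonical angle\<close>

text \<open>If \<open>V\<close> has orthonormal columns, then \<open>\<parallel>V\<^sup>* y\<parallel>\<close> is the norm of the projection \<open>z = V V\<^sup>* y\<close> of \<open>y\<close> to the column
  space, and \<open>\<parallel>z\<parallel>\<^sup>2 = y \<bullet> z\<close>. Since \<open>z\<close> also lies in the larger column space, Cauchy-Schwarz there bounds
  this by the other projection. In particular the norm depends only on the column space.\<close>

lemma norm_orthonormal_adjoint_mono:
  assumes "ctranspose V ** V = mat 1" "ctranspose V' ** V' = mat 1"
    and "column_space V \<subseteq> column_space V'"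
  shows "norm (ctranspose V *v y) \<le> norm (ctranspose V' *v y)"
proof -
  let ?z = "V *v (ctranspose V *v y)"
  obtain d where d: "?z = V' *v d"
    using assms(3) unfolding column_space_eq_range by blast
  have "norm d = norm (ctranspose V *v y)"
    using norm_orthonormal_mult[OF assms(1)] norm_orthonormal_mult[OF assms(2)] d by metis
  have "(norm (ctranspose V *v y))\<^sup>2 = y \<bullet> ?z"
    by (simp add: power2_norm_eq_inner inner_ctranspose)
  also have "\<dots> = (ctranspose V' *v y) \<bullet> d"
    by (simp add: d inner_ctranspose)
  also have "\<dots> \<le> norm (ctranspose V' *v y) * norm (ctranspose V *v y)"
    using norm_cauchy_schwarz[of "ctranspose V' *v y" d] \<open>norm d = _\<close> by simp
  finally show ?thesis
    by (cases "norm (ctranspose V *v y) = 0") (simp_all add: power2_eq_square)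
qed

lemma le_sigma_min_orthonormal_iff:
  assumes "ctranspose U ** U = mat 1"
  shows "c \<le> sigma_min (ctranspose V ** U)
    \<longleftrightarrow> (\<forall>y\<in>column_space U. c * norm y \<le> norm (ctranspose V *v y))"
  by (simp add: le_sigma_min_iff column_space_eq_range norm_orthonormal_mult[OF assms]
      flip: matrix_vector_mul_assoc)

text \<open>The value \<open>sigma_min (V\<^sup>* U)\<close> is the smallest norm of a projection of a unit vector in the column space of
  \<open>U\<close> to that of \<open>V\<close>. This does not mention the bases, so the description in \<^const>\<open>theta_max\<close>
  determines the angle uniquely.\<close>

lemma theta_max_eq_arccos:
  fixes U V :: "complex^'k^'n"
  assumes U: "ctranspose U ** U = mat 1" and V: "ctranspose V ** V = mat 1"
  shows "theta_max TYPE('k) (column_space U) (column_space V) = arccos (sigma_min (ctranspose V ** U))"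
    and "0 \<le> sigma_min (ctranspose V ** U)" "sigma_min (ctranspose V ** U) \<le> 1"
proof -
  let ?\<sigma> = "sigma_min (ctranspose V ** U)"
  show nonneg: "0 \<le> ?\<sigma>"
    by (simp add: le_sigma_min_iff)
  obtain v :: "complex^'k" where v: "norm v = 1"
  proof
    show "norm (axis undefined 1 :: complex^'k) = 1"
      by (simp add: norm_axis)
  qed
  have "?\<sigma> \<le> norm (ctranspose V ** U *v v)"
    using le_sigma_min_iff[of ?\<sigma> "ctranspose V ** U"] v by (metis mult.right_neutral order_refl)
  also have "\<dots> \<le> spectral_norm V * norm (U *v v)"
    using norm_mult_le_spectral_norm[of "ctranspose V"] by (simp flip: matrix_vector_mul_assoc)
  also have "\<dots> \<le> 1"
    using spectral_norm_le[of V 1] by (simp add: norm_orthonormal_mult[OF U] norm_orthonormal_mult[OF V] v)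
  finally show le1: "?\<sigma> \<le> 1" .
  have independent_of_basis: "sigma_min (ctranspose V' ** U') = ?\<sigma>"
    if "ctranspose U' ** U' = mat 1" "ctranspose V' ** V' = mat 1"
      "column_space U' = column_space U" "column_space V' = column_space V"
    for U' V' :: "complex^'k^'n"
  proof -
    have "norm (ctranspose V' *v y) = norm (ctranspose V *v y)" for y
      using that V by (intro antisym norm_orthonormal_adjoint_mono) auto
    then have "c \<le> sigma_min (ctranspose V' ** U') \<longleftrightarrow> c \<le> ?\<sigma>" for c
      using that U by (simp add: le_sigma_min_orthonormal_iff)
    then show ?thesis
      by (metis antisym order_refl)
  qed
  show "theta_max TYPE('k) (column_space U) (column_space V) = arccos ?\<sigma>"
    unfolding theta_max_def
  proof (rule the_equality)
    show "0 \<le> arccos ?\<sigma> \<and> arccos ?\<sigma> \<le> pi / 2 \<and>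
      (\<exists>(U' :: complex^'k^'n) (V' :: complex^'k^'n).
        ctranspose U' ** U' = mat 1 \<and> ctranspose V' ** V' = mat 1 \<and>
        column_space U' = column_space U \<and> column_space V' = column_space V \<and>
        cos (arccos ?\<sigma>) = sigma_min (ctranspose V' ** U'))"
      using nonneg le1 U V arccos_le_pi2[OF nonneg le1] by (auto simp: arccos_lbound cos_arccos)
  next
    fix \<theta>
    assume "0 \<le> \<theta> \<and> \<theta> \<le> pi / 2 \<and>
      (\<exists>(U' :: complex^'k^'n) (V' :: complex^'k^'n).
        ctranspose U' ** U' = mat 1 \<and> ctranspose V' ** V' = mat 1 \<and>
        column_space U' = column_space U \<and> column_space V' = column_space V \<and>
        cos \<theta> = sigma_min (ctranspose V' ** U'))"
    then have "0 \<le> \<theta>" "\<theta> \<le> pi / 2" "cos \<theta> = ?\<sigma>"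
      using independent_of_basis by auto
    then show "\<theta> = arccos ?\<sigma>"
      using arccos_cos[of \<theta>] by simp
  qed
qed

text \<open>If \<open>z\<close> lies in the second space and \<open>x\<close> is the foot of the perpendicular from \<open>z\<close> to the line through \<open>x\<close>,
  then \<open>x \<bullet> z = \<parallel>x\<parallel>\<^sup>2\<close> and \<open>\<parallel>z\<parallel> \<le> sqrt (1 + t\<^sup>2) \<parallel>x\<parallel>\<close>. Hence the projection of \<open>x\<close> to that space has norm at
  least \<open>\<parallel>x\<parallel> / sqrt (1 + t\<^sup>2)\<close>, which is a lower bound for the cosine of the angle.\<close>

lemma tan_theta_max_le:
  fixes Z0 Z1 :: "complex^'k^'n"
  assumes "full_column_rank Z0" "full_column_rank Z1" "0 \<le> t"
    and close: "\<And>x. x \<in> column_space Z0 \<Longrightarrow>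
      \<exists>z\<in>column_space Z1. x \<bullet> (z - x) = 0 \<and> norm (z - x) \<le> t * norm x"
  shows "theta_max TYPE('k) (column_space Z0) (column_space Z1) < pi / 2"
    and "tan (theta_max TYPE('k) (column_space Z0) (column_space Z1)) \<le> t"
proof -
  obtain U :: "complex^'k^'n" where U: "ctranspose U ** U = mat 1" "column_space U = column_space Z0"
    using orthonormal_basis_exists[OF assms(1)] .
  obtain V :: "complex^'k^'n" where V: "ctranspose V ** V = mat 1" "column_space V = column_space Z1"
    using orthonormal_basis_exists[OF assms(2)] .
  define \<sigma> where "\<sigma> = sigma_min (ctranspose V ** U)"
  define \<theta> where "\<theta> = theta_max TYPE('k) (column_space Z0) (column_space Z1)"
  have \<theta>: "\<theta> = arccos \<sigma>" and \<sigma>: "0 \<le> \<sigma>" "\<sigma> \<le> 1"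
    using theta_max_eq_arccos[OF U(1) V(1)] U(2) V(2) by (simp_all add: \<sigma>_def \<theta>_def)
  define h where "h = sqrt (1 + t\<^sup>2)"
  have h: "h > 0" "h\<^sup>2 = 1 + t\<^sup>2"
    by (simp_all add: h_def add_pos_nonneg)
  have "1 / h \<le> \<sigma>"
    unfolding \<sigma>_def le_sigma_min_orthonormal_iff[OF U(1)]
  proof
    fix y assume "y \<in> column_space U"
    then obtain z where z: "z \<in> column_space V" "y \<bullet> (z - y) = 0" "norm (z - y) \<le> t * norm y"
      using close[of y] unfolding U(2) V(2) by blast
    have "(norm z)\<^sup>2 = (norm y)\<^sup>2 + (norm (z - y))\<^sup>2"
      using z(2) by (simp add: power2_norm_eq_inner inner_diff_left inner_diff_right inner_commute)
    also have "\<dots> \<le> (norm y)\<^sup>2 + (t * norm y)\<^sup>2"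
      using z(3) by (intro add_left_mono power_mono) auto
    also have "\<dots> = (h * norm y)\<^sup>2"
      by (simp add: power_mult_distrib h algebra_simps)
    finally have "norm z \<le> h * norm y"
      using h by (simp add: power2_le_iff_abs_le)
    obtain d where d: "z = V *v d"
      using z(1) by (auto simp: column_space_eq_range)
    have "(norm y)\<^sup>2 = y \<bullet> z"
      using z(2) by (simp add: power2_norm_eq_inner inner_diff_right)
    also have "\<dots> = (ctranspose V *v y) \<bullet> d"
      by (simp add: d inner_ctranspose)
    also have "\<dots> \<le> norm (ctranspose V *v y) * norm z"
      using norm_cauchy_schwarz[of "ctranspose V *v y" d] by (simp add: d norm_orthonormal_mult[OF V(1)])
    also have "\<dots> \<le> norm (ctranspose V *v y) * (h * norm y)"
      using \<open>norm z \<le> _\<close> by (intro mult_left_mono) auto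
    finally have "norm y \<le> norm (ctranspose V *v y) * h"
      by (cases "y = 0") (simp_all add: power2_eq_square)
    then show "1 / h * norm y \<le> norm (ctranspose V *v y)"
      using h by (simp add: field_simps)
  qed
  then have pos: "\<sigma> > 0"
    using h by (smt (verit) divide_pos_pos)
  have cos: "cos \<theta> = \<sigma>"
    using \<sigma> by (simp add: \<theta> cos_arccos)
  show "\<theta> < pi / 2"
    using pos \<sigma> arccos_less_mono[of \<sigma> 0] by (simp add: \<theta>)
  have "1 / \<sigma> \<le> h"
    using \<open>1 / h \<le> \<sigma>\<close> pos h by (simp add: field_simps)
  then have "(1 / \<sigma>)\<^sup>2 \<le> h\<^sup>2"
    using pos by (intro power_mono) auto
  moreover have "1 + (tan \<theta>)\<^sup>2 = (1 / \<sigma>)\<^sup>2"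
    using tan_sec[of \<theta>] pos cos by (simp add: inverse_eq_divide power_divide)
  ultimately have "(tan \<theta>)\<^sup>2 \<le> t\<^sup>2"
    using h(2) by simp
  then show "tan \<theta> \<le> t"
    using assms(3) by (rule power2_le_imp_le)
qed

section \<open>Invariant subspaces and angles to coordinate subspaces\<close>

lemma matrix_inv_eqI:
  fixes A B :: "complex^'n^'n"
  assumes "A ** B = mat 1"
  shows "matrix_inv A = B"
proof -
  have "B ** A = mat 1"
    using assms by (simp add: matrix_left_right_inverse)
  then have "matrix_inv A ** A = mat 1"
    unfolding matrix_inv_def using assms someI[of "\<lambda>C. A ** C = mat 1 \<and> C ** A = mat 1" B] by blast
  then show ?thesis
    by (metis assms matrix_mul_assoc matrix_mul_lid matrix_mul_rid)
qed

lemma column_space_invariant: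
  assumes "B ** Z = Z ** M"
  shows "(\<lambda>x. B *v x) ` column_space Z \<subseteq> column_space Z"
  unfolding column_space_eq_range using assms by (auto simp: matrix_vector_mul_assoc)
    (auto simp flip: matrix_vector_mul_assoc)

lemma full_column_rank_if_bounded_below:
  assumes "0 < c" "\<And>u. c * norm u \<le> d * norm (W *v u)"
  shows "full_column_rank W"
  unfolding full_column_rank_def
proof (intro allI impI)
  fix u assume "W *v u = 0"
  with assms(2)[of u] have "c * norm u \<le> 0" by simp
  with \<open>0 < c\<close> show "u = 0" by (simp add: mult_le_0_iff)
qed

lemma similarity_intertwines:
  assumes "B ** S = S ** K" "K ** Z = Z ** M"
  shows "B ** (S ** Z) = (S ** Z) ** M"
proof -
  have "B ** (S ** Z) = S ** (K ** Z)"
    by (simp add: matrix_mul_assoc assms(1))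
  then show ?thesis
    by (simp add: assms(2) matrix_mul_assoc)
qed

lemma full_column_rank_mult:
  assumes "T ** S = mat 1" "full_column_rank Z"
  shows "full_column_rank (S ** Z)"
  unfolding full_column_rank_def
proof (intro allI impI)
  fix u assume "S ** Z *v u = 0"
  then have "T *v (S *v (Z *v u)) = 0"
    by (simp flip: matrix_vector_mul_assoc)
  then have "Z *v u = 0"
    by (simp add: matrix_vector_mul_assoc[of T] assms(1))
  then show "u = 0"
    using assms(2) by (simp add: full_column_rank_def)
qed

lemma full_column_rank_block_col:
  "full_column_rank W \<Longrightarrow> full_column_rank (block_col W V)"
  "full_column_rank W \<Longrightarrow> full_column_rank (block_col V W)"
  by (auto simp: full_column_rank_def block_col_mult join_eq_iff simp flip: join_zero)

lemma full_column_rank_mat: "full_column_rank (mat 1)"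
  by (simp add: full_column_rank_def)

text \<open>A square injective \<open>W\<close> is surjective, so every \<open>a\<close> is \<open>W u\<close> for some \<open>u\<close>. The vector \<open>(a, V u)\<close> of the column space
  differs from \<open>(a, 0)\<close> by the vector \<open>(0, V u)\<close>, which is orthogonal to \<open>(a, 0)\<close>.\<close>

lemma tan_theta_max_graph_le:
  fixes W :: "complex^'p^'p" and V :: "complex^'p^'q"
  assumes W: "full_column_rank W" and "0 \<le> t"
    and bound: "\<And>u. norm (V *v u) \<le> t * norm (W *v u)"
  shows "theta_max TYPE('p) (column_space (block_col (mat 1) 0 :: complex^'p^('p + 'q)))
      (column_space (block_col W V)) < pi / 2"
    and "tan (theta_max TYPE('p) (column_space (block_col (mat 1) 0 :: complex^'p^('p + 'q)))
      (column_space (block_col W V))) \<le> t"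
    and "theta_max TYPE('p) (column_space (block_col 0 (mat 1) :: complex^'p^('q + 'p)))
      (column_space (block_col V W)) < pi / 2"
    and "tan (theta_max TYPE('p) (column_space (block_col 0 (mat 1) :: complex^'p^('q + 'p)))
      (column_space (block_col V W))) \<le> t"
proof -
  obtain W' where "W' ** W = mat 1"
    using W matrix_left_invertible_ker[of W] by (auto simp: full_column_rank_def)
  then have "W ** W' = mat 1"
    by (simp add: matrix_left_right_inverse)
  then have onto: "W *v (W' *v a) = a" for a
    by (simp add: matrix_vector_mul_assoc)
  have norm_join_0: "norm (join (0 :: complex^'p) b) = norm b"
    "norm (join (b :: complex^'q) (0 :: complex^'p)) = norm b"
    "norm (join a (0 :: complex^'q)) = norm a" "norm (join (0 :: complex^'q) a) = norm a"
    for a :: "complex^'p" and b :: "complex^'q"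
    using norm_join[of 0 b] norm_join[of b 0] norm_join[of a 0] norm_join[of 0 a] by simp_all
  {
    fix x assume "x \<in> column_space (block_col (mat 1) 0 :: complex^'p^('p + 'q))"
    then obtain a where x: "x = join a 0"
      by (auto simp: column_space_eq_range block_col_mult)
    have "block_col W V *v (W' *v a) = join a (V *v (W' *v a))"
      by (simp add: block_col_mult onto)
    then have "join a (V *v (W' *v a)) \<in> column_space (block_col W V)"
      by (metis column_space_eq_range rangeI)
    then have "\<exists>z\<in>column_space (block_col W V). x \<bullet> (z - x) = 0 \<and> norm (z - x) \<le> t * norm x"
      using bound[of "W' *v a"]
      by (intro bexI[of _ "join a (V *v (W' *v a))"]) (simp_all add: x join_diff inner_join norm_join_0 onto)
  }
  from tan_theta_max_le[OF _ _ \<open>0 \<le> t\<close> this]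
  show "theta_max TYPE('p) (column_space (block_col (mat 1) 0 :: complex^'p^('p + 'q)))
      (column_space (block_col W V)) < pi / 2"
    and "tan (theta_max TYPE('p) (column_space (block_col (mat 1) 0 :: complex^'p^('p + 'q)))
      (column_space (block_col W V))) \<le> t"
    using W full_column_rank_mat by (auto intro: full_column_rank_block_col)
  {
    fix x assume "x \<in> column_space (block_col 0 (mat 1) :: complex^'p^('q + 'p))"
    then obtain a where x: "x = join 0 a"
      by (auto simp: column_space_eq_range block_col_mult)
    have "block_col V W *v (W' *v a) = join (V *v (W' *v a)) a"
      by (simp add: block_col_mult onto)
    then have "join (V *v (W' *v a)) a \<in> column_space (block_col V W)"
      by (metis column_space_eq_range rangeI)
    then have "\<exists>z\<in>column_space (block_col V W). x \<bullet> (z - x) = 0 \<and> norm (z - x) \<le> t * norm x"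
      using bound[of "W' *v a"]
      by (intro bexI[of _ "join (V *v (W' *v a)) a"]) (simp_all add: x join_diff inner_join norm_join_0 onto)
  }
  from tan_theta_max_le[OF _ _ \<open>0 \<le> t\<close> this]
  show "theta_max TYPE('p) (column_space (block_col 0 (mat 1) :: complex^'p^('q + 'p)))
      (column_space (block_col V W)) < pi / 2"
    and "tan (theta_max TYPE('p) (column_space (block_col 0 (mat 1) :: complex^'p^('q + 'p)))
      (column_space (block_col V W))) \<le> t"
    using W full_column_rank_mat by (auto intro: full_column_rank_block_col)
qed

section \<open>Block diagonalization of the unperturbed matrix\<close>

text \<open>If \<open>R\<close> solves the Sylvester equation, this similarity removes the upper right block. The number \<open>p\<close> will
  be the norm of the spectral projection \<open>[I, -R; 0, 0]\<close>, and scaling the second block column by \<open>1 / p\<close>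
  balances the two blocks so that the condition number is small.\<close>

definition decoupler :: "real \<Rightarrow> complex^'k^'m \<Rightarrow> complex^('m + 'k)^('m + 'k)" where
  "decoupler p R = block_mat (mat 1) ((1 / p) *\<^sub>R R) 0 ((1 / p) *\<^sub>R mat 1)"

definition decoupler_inv :: "real \<Rightarrow> complex^'k^'m \<Rightarrow> complex^('m + 'k)^('m + 'k)" where
  "decoupler_inv p R = block_mat (mat 1) (- R) 0 (p *\<^sub>R mat 1)"

lemma decoupler_inverse:
  assumes "p \<noteq> 0"
  shows "decoupler p R ** decoupler_inv p R = mat 1" "decoupler_inv p R ** decoupler p R = mat 1"
proof -
  show "decoupler p R ** decoupler_inv p R = mat 1"
    using assms by (simp add: decoupler_def decoupler_inv_def block_mat_mult matrix_mult_scaleR_left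
        matrix_mult_scaleR_right block_mat_identity)
  then show "decoupler_inv p R ** decoupler p R = mat 1"
    by (simp add: matrix_left_right_inverse)
qed

text \<open>In terms of \<open>a = \<parallel>v\<parallel>\<close>, \<open>b = \<parallel>w\<parallel>\<close> and \<open>\<rho> = \<parallel>R\<parallel>\<close> the two squared norms are at most the quadratic forms of
  real 2 by 2 matrices. Since \<open>p\<^sup>2 = 1 + \<rho>\<^sup>2\<close>, their largest eigenvalues are \<open>(p + \<rho>) / p\<close> and \<open>p * (p + \<rho>)\<close>.
  The product of the two bounds is the square of \<open>p + \<rho>\<close>.\<close>

lemma decoupler_norm_le:
  assumes p: "p = sqrt (1 + (spectral_norm R)\<^sup>2)"
  shows "(norm (decoupler p R *v x))\<^sup>2 \<le> (p + spectral_norm R) / p * (norm x)\<^sup>2"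
    and "(norm (decoupler_inv p R *v x))\<^sup>2 \<le> p * (p + spectral_norm R) * (norm x)\<^sup>2"
proof -
  define \<rho> where "\<rho> = spectral_norm R"
  have "\<rho> \<ge> 0" by (simp add: \<rho>_def)
  have p2: "p\<^sup>2 = 1 + \<rho>\<^sup>2" and "p > 0"
    by (simp_all add: p \<rho>_def add_pos_nonneg)
  obtain v w where x: "x = join v w" by (rule join_exhaust)
  define a where "a = norm v"
  define b where "b = norm w"
  have "norm (R *v w) \<le> \<rho> * b"
    by (simp add: \<rho>_def b_def norm_mult_le_spectral_norm)
  have "norm (v + (1 / p) *\<^sub>R (R *v w)) \<le> norm v + norm ((1 / p) *\<^sub>R (R *v w))"
    by (rule norm_triangle_ineq)
  also have "\<dots> \<le> a + \<rho> * b / p"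
    using \<open>norm (R *v w) \<le> \<rho> * b\<close> \<open>p > 0\<close> by (simp add: a_def divide_right_mono)
  finally have "(norm (decoupler p R *v x))\<^sup>2 \<le> (a + \<rho> * b / p)\<^sup>2 + (b / p)\<^sup>2"
    using \<open>p > 0\<close>
    by (simp add: decoupler_def x block_mat_mult_join scaleR_matrix_vector_mult norm_join
        b_def power_divide power_mono)
  also have "\<dots> = a\<^sup>2 + 2 * \<rho> / p * (a * b) + (1 + \<rho>\<^sup>2) / p\<^sup>2 * b\<^sup>2"
    using \<open>p > 0\<close> by (simp add: power2_eq_square field_simps)
  also have "\<dots> = a\<^sup>2 + 2 * \<rho> / p * (a * b) + b\<^sup>2"
    using \<open>p > 0\<close> by (simp flip: p2)
  also have "\<dots> \<le> a\<^sup>2 + \<rho> / p * (a\<^sup>2 + b\<^sup>2) + b\<^sup>2"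
    using mult_left_mono[OF sum_squares_bound[of a b], of "\<rho> / p"] \<open>\<rho> \<ge> 0\<close> \<open>p > 0\<close>
    by (simp add: mult_ac)
  also have "\<dots> = (p + \<rho>) / p * (a\<^sup>2 + b\<^sup>2)"
    using \<open>p > 0\<close> by (simp add: field_simps)
  finally show "(norm (decoupler p R *v x))\<^sup>2 \<le> (p + spectral_norm R) / p * (norm x)\<^sup>2"
    by (simp add: x norm_join a_def b_def \<rho>_def)
  have "norm (v - R *v w) \<le> norm v + norm (R *v w)"
    by (rule norm_triangle_ineq4)
  also have "\<dots> \<le> a + \<rho> * b"
    using \<open>norm (R *v w) \<le> \<rho> * b\<close> by (simp add: a_def)
  finally have "(norm (decoupler_inv p R *v x))\<^sup>2 \<le> (a + \<rho> * b)\<^sup>2 + (p * b)\<^sup>2"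
    using \<open>p > 0\<close>
    by (simp add: decoupler_inv_def x block_mat_mult_join scaleR_matrix_vector_mult norm_join
        b_def power_mult_distrib power_mono uminus_matrix_vector_mult)
  also have "\<dots> \<le> p * (p + \<rho>) * (a\<^sup>2 + b\<^sup>2)"
  proof -
    \<comment> \<open>The difference of the two sides is this multiple of a square, by \<open>(p + \<rho>) * (p - \<rho>) = 1\<close>.\<close>
    have "0 \<le> \<rho> * (((p + \<rho>) * a - b)\<^sup>2 / (p + \<rho>))"
      using \<open>\<rho> \<ge> 0\<close> \<open>p > 0\<close> by (intro mult_nonneg_nonneg divide_nonneg_pos) auto
    also have "((p + \<rho>) * a - b)\<^sup>2 / (p + \<rho>) = (p + \<rho>) * a\<^sup>2 - 2 * a * b + b\<^sup>2 / (p + \<rho>)"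
      using \<open>\<rho> \<ge> 0\<close> \<open>p > 0\<close> by (simp add: power2_diff field_simps) (simp add: power2_eq_square algebra_simps)
    also have "b\<^sup>2 / (p + \<rho>) = (p - \<rho>) * b\<^sup>2"
      using \<open>\<rho> \<ge> 0\<close> \<open>p > 0\<close> p2 by (simp add: field_simps power2_eq_square)
    also have "\<rho> * ((p + \<rho>) * a\<^sup>2 - 2 * a * b + (p - \<rho>) * b\<^sup>2)
        = p * (p + \<rho>) * (a\<^sup>2 + b\<^sup>2) - ((a + \<rho> * b)\<^sup>2 + (p * b)\<^sup>2) - (p\<^sup>2 - 1 - \<rho>\<^sup>2) * a\<^sup>2"
      by (simp add: power2_eq_square algebra_simps)
    finally show ?thesis using p2 by simp
  qed
  finally show "(norm (decoupler_inv p R *v x))\<^sup>2 \<le> p * (p + spectral_norm R) * (norm x)\<^sup>2"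
    by (simp add: x norm_join a_def b_def \<rho>_def)
qed

lemma spectral_norm_decoupled_le:
  assumes p: "p = sqrt (1 + (spectral_norm R)\<^sup>2)"
  shows "spectral_norm (decoupler_inv p R ** E ** decoupler p R) \<le> (p + spectral_norm R) * spectral_norm E"
proof (rule spectral_norm_le)
  fix x
  define \<rho> where "\<rho> = spectral_norm R"
  define \<epsilon> where "\<epsilon> = spectral_norm E"
  have "\<rho> \<ge> 0" "p > 0" "\<epsilon> \<ge> 0"
    by (simp_all add: p \<rho>_def \<epsilon>_def add_pos_nonneg)
  let ?y = "decoupler p R *v x"
  have "(norm (decoupler_inv p R *v (E *v ?y)))\<^sup>2 \<le> p * (p + \<rho>) * (norm (E *v ?y))\<^sup>2"
    using decoupler_norm_le(2)[OF p] by (simp add: \<rho>_def)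
  also have "\<dots> \<le> p * (p + \<rho>) * (\<epsilon> * norm ?y)\<^sup>2"
    using \<open>\<rho> \<ge> 0\<close> \<open>p > 0\<close> norm_mult_le_spectral_norm[of E ?y]
    by (intro mult_left_mono power_mono) (auto simp: \<epsilon>_def)
  also have "\<dots> = p * (p + \<rho>) * \<epsilon>\<^sup>2 * (norm ?y)\<^sup>2"
    by (simp add: power_mult_distrib)
  also have "\<dots> \<le> p * (p + \<rho>) * \<epsilon>\<^sup>2 * ((p + \<rho>) / p * (norm x)\<^sup>2)"
    using \<open>\<rho> \<ge> 0\<close> \<open>p > 0\<close> decoupler_norm_le(1)[OF p, of x]
    by (intro mult_left_mono) (auto simp: \<rho>_def)
  also have "\<dots> = ((p + \<rho>) * \<epsilon> * norm x)\<^sup>2"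
    using \<open>p > 0\<close> by (simp add: power2_eq_square)
  finally have "norm (decoupler_inv p R *v (E *v ?y)) \<le> (p + \<rho>) * \<epsilon> * norm x"
    using \<open>\<rho> \<ge> 0\<close> \<open>p > 0\<close> \<open>\<epsilon> \<ge> 0\<close> by (simp add: power2_le_iff_abs_le)
  then show "norm (decoupler_inv p R ** E ** decoupler p R *v x)
      \<le> (p + spectral_norm R) * spectral_norm E * norm x"
    by (simp add: \<rho>_def \<epsilon>_def matrix_vector_mul_assoc matrix_mul_assoc)
qed

text \<open>For the full perturbed matrix the upper right block contains \<open>A11 R + A12 - R A22\<close>, which the
  Sylvester equation for \<open>R\<close> makes zero.\<close>

lemma decoupled_block_mat:
  fixes A11 :: "complex^'m^'m" and A22 :: "complex^'k^'k"
  assumes "p \<noteq> 0"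
  shows "decoupler_inv p R ** block_mat A11 A12 A21 A22 ** decoupler p R
    = block_mat (A11 - R ** A21) ((1 / p) *\<^sub>R (A11 ** R + A12 - R ** (A21 ** R + A22)))
        (p *\<^sub>R A21) (A21 ** R + A22)"
  using assms
  by (simp add: decoupler_def decoupler_inv_def block_mat_mult matrix_mult_scaleR_left
      matrix_mult_scaleR_right matrix_mult_uminus_left matrix_mult_diff_left matrix_add_ldistrib
      matrix_add_rdistrib matrix_mul_assoc block_mat_eq_iff scaleR_diff_right scaleR_add_right)

section \<open>Perturbation of the block triangular matrix\<close>

text \<open>Three of the four blocks agree for every \<open>X\<close>; the remaining one, on the lower left, is
  \<open>K21 + K22 X - X (K11 + K12 X)\<close>.\<close>

lemma block_triangular_iff_riccati:
  fixes K11 :: "complex^'m^'m" and K22 :: "complex^'k^'k"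
  shows "matrix_inv (block_mat (mat 1) 0 X (mat 1)) ** block_mat K11 K12 K21 K22 ** block_mat (mat 1) 0 X (mat 1)
      = block_mat (K11 + K12 ** X) K12 0 (K22 - X ** K12)
    \<longleftrightarrow> riccati K11 K12 K21 K22 X"
proof -
  have "matrix_inv (block_mat (mat 1) 0 X (mat 1)) = block_mat (mat 1) 0 (- X) (mat 1)"
    by (rule matrix_inv_eqI) (simp add: block_mat_mult block_mat_identity)
  then show ?thesis
    by (simp add: block_mat_mult block_mat_eq_iff riccati_def matrix_mult_uminus_left matrix_add_ldistrib
        matrix_add_rdistrib matrix_mult_diff_left matrix_mul_assoc algebra_simps)
qed

lemma riccati_invariant_graph:
  assumes "riccati K11 K12 K21 K22 X"
  shows "block_mat K11 K12 K21 K22 ** block_col (mat 1) X = block_col (mat 1) X ** (K11 + K12 ** X)"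
  using assms by (simp add: block_mat_mult_block_col block_col_mult_matrix riccati_def)

lemma riccati_adjoint_invariant_graph:
  assumes "riccati K11 K12 K21 K22 X"
  shows "ctranspose (block_mat K11 K12 K21 K22) ** block_col (- ctranspose X) (mat 1)
    = block_col (- ctranspose X) (mat 1) ** ctranspose (K22 - X ** K12)"
  using riccati_adjoint[OF assms]
  by (simp add: ctranspose_block_mat block_mat_mult_block_col block_col_mult_matrix riccati_def
      ctranspose_diff ctranspose_mult matrix_mult_uminus_right add.commute)

theorem theorem3p21:
  fixes A11 E11 Eh11 :: "complex^'m^'m"
    and A12 E12 Eh12 R :: "complex^'k^'m"
    and E21 Eh21 :: "complex^'m^'k"
    and A22 E22 Eh22 :: "complex^'k^'k"
    and A E S :: "complex^('m + 'k)^('m + 'k)"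
    and s p :: real and \<phi> :: "real \<Rightarrow> real"
    and M :: "complex^'m^'k \<Rightarrow> complex^'m^'m"
    and N :: "complex^'m^'k \<Rightarrow> complex^'k^'k"
    and block_triangularizes :: "complex^'m^'k \<Rightarrow> bool"
  assumes A: "A = block_mat A11 A12 0 A22"
    and E: "E = block_mat E11 E12 E21 E22"
    and s: "s = sep A22 A11" and s_pos: "s > 0"
    and R: "A11 ** R - R ** A22 = - A12"
    and p: "p = sqrt (1 + (spectral_norm R)\<^sup>2)"
    and S: "S = block_mat (mat 1) ((1 / p) *\<^sub>R R) 0 ((1 / p) *\<^sub>R mat 1)"
    and \<phi>: "\<phi> = (\<lambda>\<epsilon>. (p + sqrt (p\<^sup>2 - 1)) * \<epsilon>)"
    and E_small: "spectral_norm E < s / (2 * (p + sqrt (p\<^sup>2 - 1)))"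
    and Eh11: "Eh11 = E11 - R ** E21"
    and Eh21: "Eh21 = p *\<^sub>R E21"
    and Eh12: "Eh12 = (1 / p) *\<^sub>R (E11 ** R + E12 - R ** (E21 ** R + E22))"
    and Eh22: "Eh22 = E21 ** R + E22"
    and M: "M = (\<lambda>X. A11 + Eh11 + Eh12 ** X)"
    and N: "N = (\<lambda>X. A22 + Eh22 - X ** Eh12)"
    and block_triangularizes: "block_triangularizes = (\<lambda>X.
          matrix_inv (block_mat (mat 1) 0 X (mat 1)) ** matrix_inv S
            ** block_mat (A11 + E11) (A12 + E12) E21 (A22 + E22)
            ** S ** block_mat (mat 1) 0 X (mat 1)
          = block_mat (M X) Eh12 0 (N X))"
  shows
    "(\<exists>!X. block_triangularizes X \<and> spectral_norm X \<le> 2 * (p + sqrt (p\<^sup>2 - 1)) * spectral_norm E / s)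
     \<and> pseudospectrum (\<phi> (spectral_norm E)) A11 \<inter> pseudospectrum (\<phi> (spectral_norm E)) A22 = {}
     \<and> (\<forall>X. block_triangularizes X \<and> spectral_norm X \<le> 2 * (p + sqrt (p\<^sup>2 - 1)) * spectral_norm E / s
        \<longrightarrow>
          (eig (M X) \<subseteq> pseudospectrum (\<phi> (spectral_norm E)) A11
           \<and> eig (N X) \<subseteq> pseudospectrum (\<phi> (spectral_norm E)) A22)
        \<and> (right_invariant_pair (A + E) (S ** block_col (mat 1) X, M X)
           \<and> left_invariant_pair (A + E)
               (ctranspose (matrix_inv S) ** block_col (- ctranspose X) (mat 1), N X))
        \<and> (let \<X> = column_space (block_col (mat 1) 0 :: complex^'m^('m + 'k));
               \<X>\<^sub>E = column_space (S ** block_col (mat 1) X);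
               \<theta> = theta_max TYPE('m) \<X> \<X>\<^sub>E
           in (\<lambda>x. A *v x) ` \<X> \<subseteq> \<X>
            \<and> (\<lambda>x. (A + E) *v x) ` \<X>\<^sub>E \<subseteq> \<X>\<^sub>E
            \<and> \<theta> < pi / 2
            \<and> tan \<theta> \<le> 2 * (p + sqrt (p\<^sup>2 - 1))\<^sup>2 * spectral_norm E / s)
        \<and> (let \<Y> = column_space (block_col 0 (mat 1) :: complex^'k^('m + 'k));
               \<Y>\<^sub>E = column_space
                      (ctranspose (matrix_inv S) ** block_col (- ctranspose X) (mat 1));
               \<theta> = theta_max TYPE('k) \<Y> \<Y>\<^sub>E
           in (\<lambda>x. ctranspose A *v x) ` \<Y> \<subseteq> \<Y>
            \<and> (\<lambda>x. ctranspose (A + E) *v x) ` \<Y>\<^sub>E \<subseteq> \<Y>\<^sub>E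
            \<and> \<theta> < pi / 2
            \<and> tan \<theta> \<le> 2 * (p + sqrt (p\<^sup>2 - 1))\<^sup>2 * spectral_norm E / s))"
proof -
  define \<rho> where "\<rho> = spectral_norm R"
  define \<epsilon> where "\<epsilon> = spectral_norm E"
  define \<kappa> where "\<kappa> = p + sqrt (p\<^sup>2 - 1)"
  define b where "b = 2 * \<kappa> * \<epsilon> / s"
  have "\<rho> \<ge> 0" "\<epsilon> \<ge> 0"
    by (simp_all add: \<rho>_def \<epsilon>_def)
  have "p > 0" and p2: "p\<^sup>2 = 1 + \<rho>\<^sup>2"
    by (simp_all add: p \<rho>_def add_pos_nonneg)
  have \<rho>: "sqrt (p\<^sup>2 - 1) = \<rho>"
    using \<open>\<rho> \<ge> 0\<close> by (simp add: p2)
  have \<kappa>: "\<kappa> = p + \<rho>" "\<kappa> > 0"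
    using \<open>p > 0\<close> \<open>\<rho> \<ge> 0\<close> by (simp_all add: \<kappa>_def \<rho>)
  \<comment> \<open>The number \<open>\<kappa>\<close> bounds the product of the norms of \<open>S\<close> and its inverse.\<close>
  have conj: "\<kappa> * (p - \<rho>) = 1"
    using p2 by (simp add: \<kappa> power2_eq_square algebra_simps)
  have small: "2 * (\<kappa> * \<epsilon>) < sep A22 A11"
    using E_small \<kappa>(2) by (simp add: s \<epsilon>_def \<kappa>_def[symmetric] pos_less_divide_eq mult_ac)
  then have b: "0 \<le> b" "b < 1"
    using s_pos \<kappa>(2) \<open>\<epsilon> \<ge> 0\<close> by (simp_all add: b_def s)
  have \<phi>_eq: "\<phi> \<epsilon> = \<kappa> * \<epsilon>"
    by (simp add: \<phi> \<kappa>_def)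
  have bound_eq: "2 * (p + sqrt (p\<^sup>2 - 1)) * \<epsilon> / s = b"
    by (simp add: b_def \<kappa>_def)
  have angle_eq: "2 * (p + sqrt (p\<^sup>2 - 1))\<^sup>2 * \<epsilon> / s = \<kappa> * b"
    by (simp add: b_def \<kappa>_def power2_eq_square)

  define T where "T = decoupler_inv p R"
  have S_eq: "S = decoupler p R"
    by (simp add: S decoupler_def)
  have ST: "S ** T = mat 1" "T ** S = mat 1"
    using decoupler_inverse[of p R] \<open>p > 0\<close> by (simp_all add: S_eq T_def)
  have inv_S: "matrix_inv S = T"
    by (rule matrix_inv_eqI) (rule ST)
  define K where "K = block_mat (A11 + Eh11) Eh12 Eh21 (A22 + Eh22)"
  have AE: "A + E = block_mat (A11 + E11) (A12 + E12) E21 (A22 + E22)"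
    by (simp add: A E block_mat_add)
  have A12: "A12 = R ** A22 - A11 ** R"
    using R by (simp add: algebra_simps)
  have K_eq: "T ** (A + E) ** S = K"
    unfolding T_def S_eq AE K_def decoupled_block_mat[OF less_imp_neq[OF \<open>p > 0\<close>, symmetric]]
    by (simp add: block_mat_eq_iff Eh11 Eh12 Eh21 Eh22 A12 matrix_add_ldistrib matrix_add_rdistrib
        matrix_mul_assoc algebra_simps)
  have "block_mat Eh11 Eh12 Eh21 Eh22 = T ** E ** S"
    unfolding T_def S_eq E decoupled_block_mat[OF less_imp_neq[OF \<open>p > 0\<close>, symmetric]]
    by (simp add: Eh11 Eh12 Eh21 Eh22)
  then have F: "spectral_norm (block_mat Eh11 Eh12 Eh21 Eh22) \<le> \<kappa> * \<epsilon>"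
    using spectral_norm_decoupled_le[OF p, of E] by (simp add: T_def S_eq \<kappa> \<rho>_def \<epsilon>_def)
  define is_graph where "is_graph = riccati (A11 + Eh11) Eh12 Eh21 (A22 + Eh22)"
  have triangular_iff: "block_triangularizes X \<longleftrightarrow> is_graph X" for X
  proof -
    have "matrix_inv (block_mat (mat 1) 0 X (mat 1)) ** matrix_inv S
        ** block_mat (A11 + E11) (A12 + E12) E21 (A22 + E22) ** S ** block_mat (mat 1) 0 X (mat 1)
      = matrix_inv (block_mat (mat 1) 0 X (mat 1)) ** K ** block_mat (mat 1) 0 X (mat 1)"
      unfolding K_eq[symmetric] AE inv_S by (simp add: matrix_mul_assoc)
    then show ?thesis
      unfolding block_triangularizes M N is_graph_def block_triangular_iff_riccati[symmetric]
      by (simp add: K_def)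
  qed

  have "\<exists>!X. is_graph X \<and> spectral_norm X \<le> b"
  proof -
    obtain X where "is_graph X" "spectral_norm X \<le> b"
      using riccati_solution_exists[OF s s_pos F] small
      by (auto simp: is_graph_def b_def s mult.assoc)
    moreover have "X = Y" if "is_graph X" "spectral_norm X \<le> b" "is_graph Y" "spectral_norm Y \<le> b" for X Y
      using that b riccati_solution_unique[OF _ _ _ _ F small, of X Y] by (simp add: is_graph_def)
    ultimately show ?thesis by blast
  qed
  moreover have "pseudospectrum (\<kappa> * \<epsilon>) A11 \<inter> pseudospectrum (\<kappa> * \<epsilon>) A22 = {}"
    using pseudospectra_disjoint[OF small] by blast
  moreover
  {
    fix X assume X: "is_graph X" "spectral_norm X \<le> b"
    define x where "x = spectral_norm X"
    have x: "0 \<le> x" "x \<le> b" "x \<le> 1"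
      using X b by (simp_all add: x_def)
    define Z where "Z = S ** block_col (mat 1) X"
    define Y where "Y = ctranspose T ** block_col (- ctranspose X) (mat 1)"
    have "eig (M X) \<subseteq> pseudospectrum (\<kappa> * \<epsilon>) A11"
      using eig_subset_pseudospectrum[OF _ _ F small] X(1) x by (simp add: M is_graph_def x_def)
    moreover have "eig (N X) \<subseteq> pseudospectrum (\<kappa> * \<epsilon>) A22"
      using eig_subset_pseudospectrum_complementary[OF _ _ F small] X(1) x
      by (simp add: N is_graph_def x_def)
    moreover have Z_inv: "(A + E) ** Z = Z ** M X"
    proof -
      have "(A + E) ** S = S ** K"
        unfolding K_eq[symmetric] by (simp add: matrix_mul_assoc ST)
      moreover have "K ** block_col (mat 1) X = block_col (mat 1) X ** M X"
        using riccati_invariant_graph X(1) by (simp add: K_def M is_graph_def)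
      ultimately show ?thesis
        unfolding Z_def by (rule similarity_intertwines)
    qed
    moreover have Y_inv: "ctranspose (A + E) ** Y = Y ** ctranspose (N X)"
    proof -
      have "T ** (A + E) = K ** T"
        unfolding K_eq[symmetric] by (simp add: ST flip: matrix_mul_assoc)
      then have "ctranspose (A + E) ** ctranspose T = ctranspose T ** ctranspose K"
        by (metis ctranspose_mult)
      moreover have "ctranspose K ** block_col (- ctranspose X) (mat 1)
          = block_col (- ctranspose X) (mat 1) ** ctranspose (N X)"
        using riccati_adjoint_invariant_graph X(1) by (simp add: K_def N is_graph_def)
      ultimately show ?thesis
        unfolding Y_def by (rule similarity_intertwines)
    qed
    moreover have Z_rank: "full_column_rank Z"
      unfolding Z_def
      by (intro full_column_rank_mult[OF ST(2)] full_column_rank_block_col full_column_rank_mat)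
    moreover have Y_rank: "full_column_rank Y"
    proof -
      have "ctranspose S ** ctranspose T = mat 1"
        by (metis ST(2) ctranspose_mat ctranspose_mult)
      then show ?thesis
        unfolding Y_def
        by (intro full_column_rank_mult full_column_rank_block_col full_column_rank_mat)
    qed
    moreover have "ctranspose Y ** (A + E) = N X ** ctranspose Y"
      using arg_cong[OF Y_inv, of ctranspose] by (simp add: ctranspose_mult)
    moreover have "A ** block_col (mat 1) 0 = block_col (mat 1) 0 ** A11"
      by (simp add: A block_mat_mult_block_col block_col_mult_matrix)
    moreover have "ctranspose A ** block_col 0 (mat 1) = block_col 0 (mat 1) ** ctranspose A22"
      by (simp add: A ctranspose_block_mat block_mat_mult_block_col block_col_mult_matrix)
    moreover
    \<comment> \<open>Both angles come from graphs with \<open>\<parallel>V u\<parallel> \<le> x \<parallel>u\<parallel>\<close> and \<open>\<parallel>W u\<parallel> \<ge> (p - \<rho> x) \<parallel>u\<parallel>\<close>, up to the common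
      factor \<open>1 / p\<close> in the first case; \<open>x \<le> 1\<close> gives \<open>p - \<rho> x \<ge> p - \<rho> = 1 / \<kappa>\<close>.\<close>
    have gap: "p - \<rho> * x > 0" "x \<le> \<kappa> * b * (p - \<rho> * x)"
    proof -
      have "p - \<rho> > 0"
        using conj \<kappa>(2) by (metis zero_less_mult_pos zero_less_one)
      moreover have le: "p - \<rho> \<le> p - \<rho> * x"
        using x \<open>\<rho> \<ge> 0\<close> by (simp add: mult_left_le)
      ultimately show "p - \<rho> * x > 0" by linarith
      have "x \<le> b * (\<kappa> * (p - \<rho>))"
        using x by (simp add: conj)
      also have "\<dots> \<le> b * (\<kappa> * (p - \<rho> * x))"
        using le b \<kappa>(2) by (intro mult_left_mono) auto
      finally show "x \<le> \<kappa> * b * (p - \<rho> * x)"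
        by (simp add: mult_ac)
    qed
    define W1 where "W1 = mat 1 + (1 / p) *\<^sub>R (R ** X)"
    define W2 where "W2 = ctranspose R ** ctranspose X + p *\<^sub>R mat 1"
    have Z_eq: "Z = block_col W1 ((1 / p) *\<^sub>R X)"
      by (simp add: Z_def S W1_def block_mat_mult_block_col matrix_mult_scaleR_left)
    have Y_eq: "Y = block_col (- ctranspose X) W2"
      by (simp add: Y_def T_def decoupler_inv_def W2_def ctranspose_block_mat ctranspose_uminus
          ctranspose_scaleR block_mat_mult_block_col matrix_mult_uminus_left matrix_mult_uminus_right
          matrix_mult_scaleR_left)
    have W2_le: "(p - \<rho> * x) * norm u \<le> norm (W2 *v u)" for u
    proof -
      have "norm (ctranspose R *v (ctranspose X *v u)) \<le> \<rho> * norm (ctranspose X *v u)"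
        using norm_mult_le_spectral_norm[of "ctranspose R"] by (simp add: \<rho>_def)
      also have "\<dots> \<le> \<rho> * (x * norm u)"
        using norm_mult_le_spectral_norm[of "ctranspose X" u] \<open>\<rho> \<ge> 0\<close>
        by (intro mult_left_mono) (simp_all add: x_def)
      finally show ?thesis
        using norm_triangle_ineq2[of "p *\<^sub>R u" "- (ctranspose R *v (ctranspose X *v u))"] \<open>p > 0\<close>
        by (simp add: W2_def matrix_vector_mult_add_rdistrib scaleR_matrix_vector_mult
            matrix_vector_mul_assoc[symmetric] algebra_simps)
    qed
    have W1_le: "(p - \<rho> * x) * norm u \<le> p * norm (W1 *v u)" for u
    proof -
      have "norm (R *v (X *v u)) \<le> \<rho> * norm (X *v u)"
        using norm_mult_le_spectral_norm[of R] by (simp add: \<rho>_def)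
      also have "\<dots> \<le> \<rho> * (x * norm u)"
        using norm_mult_le_spectral_norm[of X u] \<open>\<rho> \<ge> 0\<close>
        by (intro mult_left_mono) (simp_all add: x_def)
      finally have "(p - \<rho> * x) * norm u \<le> norm (p *\<^sub>R u + R *v (X *v u))"
        using norm_triangle_ineq2[of "p *\<^sub>R u" "- (R *v (X *v u))"] \<open>p > 0\<close>
        by (simp add: algebra_simps)
      also have "p *\<^sub>R u + R *v (X *v u) = p *\<^sub>R (W1 *v u)"
        using \<open>p > 0\<close>
        by (simp add: W1_def matrix_vector_mult_add_rdistrib scaleR_matrix_vector_mult
            matrix_vector_mul_assoc[symmetric] scaleR_add_right)
      finally show ?thesis using \<open>p > 0\<close> by simp
    qed
    have "full_column_rank W1" "full_column_rank W2"
      using full_column_rank_if_bounded_below[OF gap(1), of p W1] W1_le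
        full_column_rank_if_bounded_below[OF gap(1), of 1 W2] W2_le by simp_all
    have "norm ((1 / p) *\<^sub>R X *v u) \<le> \<kappa> * b * norm (W1 *v u)" for u
    proof -
      have "p * norm ((1 / p) *\<^sub>R X *v u) = norm (X *v u)"
        using \<open>p > 0\<close> by (simp add: scaleR_matrix_vector_mult)
      also have "\<dots> \<le> x * norm u"
        by (simp add: x_def norm_mult_le_spectral_norm)
      also have "\<dots> \<le> \<kappa> * b * ((p - \<rho> * x) * norm u)"
        using mult_right_mono[OF gap(2) norm_ge_zero[of u]] by (simp add: mult.assoc)
      also have "\<dots> \<le> \<kappa> * b * (p * norm (W1 *v u))"
        using W1_le b \<kappa>(2) by (intro mult_left_mono) auto
      finally show ?thesis
        using \<open>p > 0\<close> by (simp add: mult_ac)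
    qed
    note angle_X = tan_theta_max_graph_le(1,2)[OF \<open>full_column_rank W1\<close> _ this, folded Z_eq]
    have "norm (- ctranspose X *v u) \<le> \<kappa> * b * norm (W2 *v u)" for u
    proof -
      have "norm (- ctranspose X *v u) \<le> x * norm u"
        using norm_mult_le_spectral_norm[of "ctranspose X" u]
        by (simp add: x_def uminus_matrix_vector_mult)
      also have "\<dots> \<le> \<kappa> * b * ((p - \<rho> * x) * norm u)"
        using mult_right_mono[OF gap(2) norm_ge_zero[of u]] by (simp add: mult.assoc)
      also have "\<dots> \<le> \<kappa> * b * norm (W2 *v u)"
        using W2_le b \<kappa>(2) by (intro mult_left_mono) auto
      finally show ?thesis .
    qed
    note angle_Y = tan_theta_max_graph_le(3,4)[OF \<open>full_column_rank W2\<close> _ this, folded Y_eq]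
    note angle_X angle_Y
    ultimately have
      "(eig (M X) \<subseteq> pseudospectrum (\<kappa> * \<epsilon>) A11 \<and> eig (N X) \<subseteq> pseudospectrum (\<kappa> * \<epsilon>) A22)
        \<and> (right_invariant_pair (A + E) (Z, M X) \<and> left_invariant_pair (A + E) (Y, N X))
        \<and> (let \<X> = column_space (block_col (mat 1) 0 :: complex^'m^('m + 'k));
               \<X>\<^sub>E = column_space Z;
               \<theta> = theta_max TYPE('m) \<X> \<X>\<^sub>E
           in (\<lambda>x. A *v x) ` \<X> \<subseteq> \<X> \<and> (\<lambda>x. (A + E) *v x) ` \<X>\<^sub>E \<subseteq> \<X>\<^sub>E
            \<and> \<theta> < pi / 2 \<and> tan \<theta> \<le> \<kappa> * b)
        \<and> (let \<Y> = column_space (block_col 0 (mat 1) :: complex^'k^('m + 'k));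
               \<Y>\<^sub>E = column_space Y;
               \<theta> = theta_max TYPE('k) \<Y> \<Y>\<^sub>E
           in (\<lambda>x. ctranspose A *v x) ` \<Y> \<subseteq> \<Y> \<and> (\<lambda>x. ctranspose (A + E) *v x) ` \<Y>\<^sub>E \<subseteq> \<Y>\<^sub>E
            \<and> \<theta> < pi / 2 \<and> tan \<theta> \<le> \<kappa> * b)"
      using b \<kappa>(2) unfolding Let_def
      by (intro conjI)
         (simp_all add: right_invariant_pair_def left_invariant_pair_def rank_full_column_rank
          column_space_invariant)
  }
  ultimately show ?thesis
    unfolding triangular_iff bound_eq angle_eq inv_S \<epsilon>_def[symmetric] \<phi>_eq by blast
qed

end
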